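(* Consider the high-dimensional setting described in the context, with $s_0=o(\sqrt n)$. Assume that there is a constant $C_0>0$ (not depending on $n$) such that the eigenvalues $0<\lambda_1(\Sigma)\le\cdots\le\lambda_p(\Sigma)$ of $\Sigma$ satisfy $C_0\le\lambda_1(\Sigma)\le\lambda_p(\Sigma)\le C_0^{-1}$. Then $$\max_{i=1,\dots,p}\|\hat w_{i1}-w_{i1}\| = O_P\big(s_0\sqrt{\log p/n}\big)\quad\text{as } n\to\infty .$$ If moreover $\|\Omega\|_1<\infty$ (i.e. $\|\Omega\|_1$ is bounded by a constant not depending on $n$), then $$\|\hat\Omega-\Omega\|_1=O_P\big(s_0\sqrt{\log p/n}\big)\quad\text{as } n\to\infty .$$
   Context: Asymptotic setting: everything is indexed by the sample size $n\to\infty$; the dimension $p=p_n$ grows with $n$, and the sparsity $s_0=s_{0,n}\ge 1$ and the matrices below may depend on $n$. $X_1,\dots,X_n$ are i.i.d. random vectors from $N(\mu,\Sigma)$ in $\mathbb R^p$, with $\Sigma$ symmetric positive definite, and $\Omega=\Sigma^{-1}$ is the precision matrix, with columns $w_1,\dots,w_p$. The positions of the nonzero entries of $\Omega$ are known, and each column of $\Omega$ has exactly $s_0$ nonzero entries. For $i=1,\dots,p$, let $w_{i1}\in\mathbb R^{s_0}$ be the vector of the nonzero entries of $w_i$ (in their order of appearance), and let $B_i$ be the $p\times s_0$ zero-one matrix whose columns are the standard basis vectors of $\mathbb R^p$ indexed by the support of $w_i$, in increasing order, so that $B_iw_{i1}=w_i$. Let $e_i$ be the $i$-th standard basis vector of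 $\mathbb R^p$ and $\mathbf f_i=B_i^Te_i\in\mathbb R^{s_0}$. Let $\bar X=\frac1n\sum_{k=1}^nX_k$, let $S_n=\frac1{n-1}\sum_{k=1}^n(X_k-\bar X)(X_k-\bar X)^T$ be the sample covariance matrix, and $S_{ni}=B_i^TS_nB_i$ (almost surely invertible when $n>s_0$). The estimator of $w_{i1}$ is $\hat w_{i1}=(B_i^TS_nB_i)^{-1}B_i^Te_i=S_{ni}^{-1}\mathbf f_i$; the estimator of $w_i$ is $\hat w_i=B_i\hat w_{i1}$, and $\hat\Omega=(\hat w_1,\dots,\hat w_p)$. $\|\cdot\|$ is the Euclidean norm of a vector; for a matrix $A=(a_{ij})$, $\|A\|_1=\max_j\sum_i|a_{ij}|$. $X_n=O_P(Y_n)$ means that $X_n/Y_n$ is bounded in probability.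
   Formalization: The formal theorem adds the assumption log p = O(n); without an upper bound on p the claim is false, e.g. for Σ = I, s_0 = 1, p = 2^(n^2), where the largest error of 1/S_ii exceeds any multiple of the claimed rate. *)

theory Defs
  imports
    "HOL-Probability.Probability"
    "HOL-Library.Landau_Symbols"
    "Jordan_Normal_Form.Gauss_Jordan_Elimination"
    "Jordan_Normal_Form.Char_Poly"
begin

text \<open>The dimensions depend on the sample size, so vectors and matrices are those of
  Jordan_Normal_Form, whose dimensions are values; the notation of HOL-Analysis is switched off.\<close>

no_notation inner (infix \<open>\<bullet>\<close> 70)
no_notation vec_nth (infixl \<open>$\<close> 90)

definition l2_norm :: "real vec \<Rightarrow> real" where
  "l2_norm v = sqrt (v \<bullet> v)"

definition mat_norm1 :: "real mat \<Rightarrow> real" where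
  "mat_norm1 A = Max ((\<lambda>j. \<Sum>i<dim_row A. \<bar>A $$ (i, j)\<bar>) ` {..<dim_col A})"

text \<open>On a non-invertible matrix the value is an unspecified constant. This matters only for the
  blocks of the sample covariance matrix, and there with probability zero (for n larger than the
  size of the block).\<close>

definition mat_inv :: "real mat \<Rightarrow> real mat" where
  "mat_inv A = the (mat_inverse A)"

definition pos_def_mat :: "nat \<Rightarrow> real mat \<Rightarrow> bool" where
  "pos_def_mat d A \<longleftrightarrow> A \<in> carrier_mat d d \<and> transpose_mat A = A \<and>
     (\<forall>v \<in> carrier_vec d. v \<noteq> 0\<^sub>v d \<longrightarrow> v \<bullet> (A *\<^sub>v v) > 0)"

text \<open>The distribution N(\<open>\<mu>\<close>, \<open>\<Sigma>\<close>) for positive definite \<open>\<Sigma>\<close>: every nontrivial linear combination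
  \<open>a \<bullet> X\<close> of the coordinates is univariate normal with mean \<open>a \<bullet> \<mu>\<close> and variance \<open>a \<bullet> \<Sigma> a\<close>.
  The second parameter of the library's normal density is the standard deviation.\<close>

definition multivariate_normal ::
    "'a measure \<Rightarrow> nat \<Rightarrow> ('a \<Rightarrow> real vec) \<Rightarrow> real vec \<Rightarrow> real mat \<Rightarrow> bool" where
  "multivariate_normal M d X \<mu> \<Sigma> \<longleftrightarrow>
     (\<forall>\<omega> \<in> space M. X \<omega> \<in> carrier_vec d) \<and>
     (\<forall>a \<in> carrier_vec d. a \<noteq> 0\<^sub>v d \<longrightarrow>
        distributed M lborel (\<lambda>\<omega>. a \<bullet> X \<omega>) (normal_density (a \<bullet> \<mu>) (sqrt (a \<bullet> (\<Sigma> *\<^sub>v a)))))"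

text \<open>The random vectors \<open>X 0, \<dots>, X (n - 1)\<close> are i.i.d. from N(\<open>\<mu>\<close>, \<open>\<Sigma>\<close>). The product
  sigma-algebra on the index set \<open>{..<d}\<close> plays the role of the Borel sets of d-space.\<close>

definition iid_multivariate_normal ::
    "'a measure \<Rightarrow> nat \<Rightarrow> nat \<Rightarrow> (nat \<Rightarrow> 'a \<Rightarrow> real vec) \<Rightarrow> real vec \<Rightarrow> real mat \<Rightarrow> bool" where
  "iid_multivariate_normal M n d X \<mu> \<Sigma> \<longleftrightarrow>
     (\<forall>k<n. multivariate_normal M d (X k) \<mu> \<Sigma>) \<and>
     prob_space.indep_vars M (\<lambda>_. \<Pi>\<^sub>M j\<in>{..<d}. borel) (\<lambda>k \<omega>. \<lambda>j\<in>{..<d}. X k \<omega> $ j) {..<n}"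

text \<open>Here \<open>x\<close> is the realised sample \<open>x 0, \<dots>, x (n - 1)\<close> of d-vectors.\<close>

definition sample_mean :: "nat \<Rightarrow> nat \<Rightarrow> (nat \<Rightarrow> real vec) \<Rightarrow> real vec" where
  "sample_mean d n x = vec d (\<lambda>j. (\<Sum>k<n. x k $ j) / real n)"

definition sample_cov :: "nat \<Rightarrow> nat \<Rightarrow> (nat \<Rightarrow> real vec) \<Rightarrow> real mat" where
  "sample_cov d n x = mat d d (\<lambda>(i, j).
     (\<Sum>k<n. (x k $ i - sample_mean d n x $ i) * (x k $ j - sample_mean d n x $ j)) / (real n - 1))"

text \<open>The known graphical structure: row indices (increasing) of the nonzero entries of a column.\<close>

definition col_support :: "real mat \<Rightarrow> nat \<Rightarrow> nat list" where
  "col_support \<Omega> i = filter (\<lambda>j. \<Omega> $$ (j, i) \<noteq> 0) [0..<dim_row \<Omega>]"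

definition sel_mat :: "real mat \<Rightarrow> nat \<Rightarrow> real mat" where
  "sel_mat \<Omega> i = mat_of_cols (dim_row \<Omega>) (map (unit_vec (dim_row \<Omega>)) (col_support \<Omega> i))"

definition nz_col :: "real mat \<Rightarrow> nat \<Rightarrow> real vec" where
  "nz_col \<Omega> i = vec_of_list (map (\<lambda>j. \<Omega> $$ (j, i)) (col_support \<Omega> i))"

text \<open>The estimators depend on \<open>\<Omega>\<close> only through the positions of its nonzero entries.\<close>

definition nz_col_est :: "real mat \<Rightarrow> real mat \<Rightarrow> nat \<Rightarrow> real vec" where
  "nz_col_est \<Omega> S i =
     mat_inv (transpose_mat (sel_mat \<Omega> i) * S * sel_mat \<Omega> i) *\<^sub>v
       (transpose_mat (sel_mat \<Omega> i) *\<^sub>v unit_vec (dim_row \<Omega>) i)"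

definition prec_est :: "real mat \<Rightarrow> real mat \<Rightarrow> real mat" where
  "prec_est \<Omega> S = mat_of_cols (dim_row \<Omega>)
     (map (\<lambda>i. sel_mat \<Omega> i *\<^sub>v nz_col_est \<Omega> S i) [0..<dim_col \<Omega>])"

definition max_col_error :: "real mat \<Rightarrow> real mat \<Rightarrow> real" where
  "max_col_error \<Omega> S =
     Max ((\<lambda>i. l2_norm (nz_col_est \<Omega> S i - nz_col \<Omega> i)) ` {..<dim_col \<Omega>})"

text \<open>\<open>Z n = O\<^sub>P(r n)\<close>, where \<open>Z n\<close> lives on its own probability space \<open>M n\<close>. If the exceptional set
  is measurable, it can itself be taken as \<open>A\<close>, and the condition says that it has probability at
  most \<open>\<epsilon>\<close>. Covering it by an event avoids that a non-measurable set counts as having measure 0;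
  multiplying by \<open>r n\<close> avoids that division by 0 yields 0.\<close>

definition bigO_in_prob ::
    "(nat \<Rightarrow> 'a measure) \<Rightarrow> (nat \<Rightarrow> 'a \<Rightarrow> real) \<Rightarrow> (nat \<Rightarrow> real) \<Rightarrow> bool" where
  "bigO_in_prob M Z r \<longleftrightarrow>
     (\<forall>\<epsilon>>0. \<exists>K. \<forall>\<^sub>F n in sequentially. \<exists>A \<in> sets (M n).
        {\<omega> \<in> space (M n). \<bar>Z n \<omega>\<bar> > K * \<bar>r n\<bar>} \<subseteq> A \<and> measure (M n) A \<le> \<epsilon>)"

lemma sel_mat_mult_nz_col:
  assumes "i < dim_col \<Omega>"
  shows "sel_mat \<Omega> i *\<^sub>v nz_col \<Omega> i = col \<Omega> i"
proof (rule eq_vecI)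
  let ?l = "col_support \<Omega> i"
  show "dim_vec (sel_mat \<Omega> i *\<^sub>v nz_col \<Omega> i) = dim_vec (col \<Omega> i)"
    by (simp add: sel_mat_def)
  fix r assume "r < dim_vec (col \<Omega> i)"
  then have r: "r < dim_row \<Omega>" by simp
  have d: "distinct ?l" and s: "set ?l = {j. j < dim_row \<Omega> \<and> \<Omega> $$ (j, i) \<noteq> 0}"
    by (auto simp: col_support_def)
  have "(sel_mat \<Omega> i *\<^sub>v nz_col \<Omega> i) $ r
      = (\<Sum>k\<in>{0..<length ?l}. (if ?l ! k = r then 1 else 0) * \<Omega> $$ (?l ! k, i))"
    using r s nth_mem[of _ ?l]
    by (auto simp: sel_mat_def nz_col_def scalar_prod_def mat_of_cols_def vec_of_list_index
        intro!: sum.cong)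
  also have "\<dots> = (\<Sum>j\<in>set ?l. (if j = r then 1 else 0) * \<Omega> $$ (j, i))"
    by (rule sum.reindex_bij_betw[where g = "\<lambda>j. (if j = r then 1 else 0) * \<Omega> $$ (j, i)"])
      (use d in \<open>simp add: bij_betw_nth atLeast0LessThan\<close>)
  also have "\<dots> = (\<Sum>j\<in>set ?l. if j = r then \<Omega> $$ (r, i) else 0)"
    by (intro sum.cong) auto
  also have "\<dots> = \<Omega> $$ (r, i)" using r s by auto
  finally show "(sel_mat \<Omega> i *\<^sub>v nz_col \<Omega> i) $ r = col \<Omega> i $ r"
    using r assms by simp
qed

end

theory Submission
  imports Defs
begin

text \<open>Write \<open>S\<close> for the sample covariance matrix, \<open>w\<close> for the nonzero part of a column of
  \<open>\<Omega>\<close>, \<open>S\<^sub>i\<close> and \<open>\<Sigma>\<^sub>i\<close> for the blocks of \<open>S\<close> and \<open>\<Sigma>\<close> on its support, and \<open>f\<close> for the restricted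
  unit vector. Since \<open>\<Sigma> \<Omega> = 1\<close>, the true \<open>w\<close> solves \<open>\<Sigma>\<^sub>i w = f\<close>, while the estimator solves
  \<open>S\<^sub>i w' = f\<close>. Hence the error \<open>d = w' - w\<close> solves \<open>S\<^sub>i d = f - S\<^sub>i w\<close>, whose right-hand side is a
  restriction of the column of \<open>(\<Sigma> - S) \<Omega>\<close>. If all entries of \<open>(\<Sigma> - S) \<Omega>\<close> are at most \<open>\<rho>\<close> and
  \<open>S\<^sub>i\<close> is bounded below by \<open>c\<close> as a quadratic form, then \<open>c |d|\<^sup>2 \<le> d \<bullet> S\<^sub>i d \<le> |d| sqrt s0 \<rho>\<close>, so that
  \<open>|d| \<le> sqrt s0 \<rho> / c\<close> and the 1-norm of \<open>d\<close> is at most \<open>s0 \<rho> / c\<close>. This is lemma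
  \<open>nz_col_est_error\<close>. It remains to find \<open>\<rho>\<close> of order \<open>sqrt (ln p / n)\<close> and a constant \<open>c\<close>, uniformly
  over the \<open>p\<close> columns, with probability tending to 1.

  For \<open>\<rho>\<close>, let \<open>v\<close> be a column of \<open>\<Omega>\<close> and \<open>e\<close> a unit vector. Polarization reduces the entry
  \<open>e \<bullet> (S - \<Sigma>) v\<close> to the quadratic forms at \<open>e + v\<close> and \<open>e - v\<close>. Each form \<open>a \<bullet> S a\<close> is the sample variance of the univariate normal sample \<open>a \<bullet> X k\<close>, and a
  Chernoff bound for sums of squared standard normals, at the deviation \<open>sqrt (ln p / n)\<close>, fails
  with probability \<open>O(p powr -4)\<close>. There are only \<open>O(p\<^sup>2)\<close> vectors \<open>a\<close> to consider.

  For \<open>c\<close>, a perturbation argument around \<open>\<Sigma>\<^sub>i\<close> is not available: \<open>ln p\<close> may be of the same order as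
  \<open>n\<close>, and then \<open>S\<^sub>i\<close> does not converge to \<open>\<Sigma>\<^sub>i\<close> uniformly in \<open>i\<close>. What helps is that the sample
  variance of \<open>n\<close> normals falls below a constant \<open>\<tau>\<close> only with probability \<open>exp (- B n / 3)\<close>, where
  \<open>B\<close> is as large as desired if \<open>\<tau>\<close> is small (lemma \<open>std_normal_centered_ss_small_ball\<close>). This
  beats the \<open>p \<le> exp (A n)\<close> columns together with an integer grid of mesh of order \<open>1 / s0\<close> on each
  block, whose cardinality \<open>exp (O(s0\<^sup>2))\<close> is \<open>exp (o(n))\<close> because \<open>s0 = o(sqrt n)\<close>. Lemma
  \<open>integer_net_lower_bound\<close> passes from the grid to the whole block.\<close>

section \<open>Tail bounds for the sample variance of a standard normal sample\<close>

text \<open>Multiplying the standard normal density by \<open>exp (s x\<^sup>2)\<close> only changes its variance, to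
  \<open>1 / (1 - 2 s)\<close>, up to a constant factor.\<close>

lemma (in prob_space) exp_square_moment:
  assumes Z: "distributed M lborel Z std_normal_density" and s: "s < 1/2"
  shows "integrable M (\<lambda>\<omega>. exp (s * (Z \<omega>)\<^sup>2))"
    and "expectation (\<lambda>\<omega>. exp (s * (Z \<omega>)\<^sup>2)) = 1 / sqrt (1 - 2 * s)"
proof -
  define \<tau> where "\<tau> = 1 / sqrt (1 - 2 * s)"
  have tau: "\<tau> > 0" "\<tau>\<^sup>2 = 1 / (1 - 2 * s)"
    using s by (auto simp: \<tau>_def power_divide)
  have "std_normal_density x * exp (s * x\<^sup>2) = \<tau> * normal_density 0 \<tau> x" for x
  proof -
    have "exp (- (x\<^sup>2 / 2)) * exp (s * x\<^sup>2) = exp (- (x\<^sup>2 / (2 * \<tau>\<^sup>2)))"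
      using s unfolding tau(2) exp_add[symmetric] by (simp add: field_simps)
    moreover have "sqrt (2 * pi * \<tau>\<^sup>2) = sqrt (2 * pi) * \<tau>"
      using tau(1) by (simp add: real_sqrt_mult)
    ultimately show ?thesis
      using tau(1) by (simp add: normal_density_def)
  qed
  then have *: "(\<lambda>x. std_normal_density x * exp (s * x\<^sup>2)) = (\<lambda>x. \<tau> * normal_density 0 \<tau> x)"
    by auto
  have "integrable lborel (\<lambda>x. std_normal_density x * exp (s * x\<^sup>2))"
    unfolding * using tau by (intro integrable_mult_right integrable_normal_density)
  then show "integrable M (\<lambda>\<omega>. exp (s * (Z \<omega>)\<^sup>2))"
    by (subst (asm) distributed_integrable[OF Z]) (auto)
  have "(\<integral>x. std_normal_density x * exp (s * x\<^sup>2) \<partial>lborel) = \<tau>"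
    unfolding * using tau(1) by simp
  then show "expectation (\<lambda>\<omega>. exp (s * (Z \<omega>)\<^sup>2)) = 1 / sqrt (1 - 2 * s)"
    by (subst (asm) distributed_integral[OF Z]) (auto simp: \<tau>_def)
qed

text \<open>Stated with \<open>s\<close> on the inside, so that \<open>s > 0\<close> bounds the upper tail of the sum and \<open>s < 0\<close> the
  lower tail.\<close>

lemma (in prob_space) chernoff_sum_squares:
  assumes I: "finite I" "I \<noteq> {}" and ind: "indep_vars (\<lambda>_. borel) Z I"
    and Z: "\<And>i. i \<in> I \<Longrightarrow> distributed M lborel (Z i) std_normal_density"
    and s: "s < 1/2"
  shows "prob {\<omega> \<in> space M. u \<le> s * (\<Sum>i\<in>I. (Z i \<omega>)\<^sup>2)}
           \<le> exp (- u) * (1 / sqrt (1 - 2 * s)) ^ card I"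
proof -
  have rv [measurable]: "Z i \<in> borel_measurable M" if "i \<in> I" for i
    using Z[OF that] by (auto simp: distributed_def)
  have ind': "indep_vars (\<lambda>_. borel) (\<lambda>i \<omega>. exp (s * (Z i \<omega>)\<^sup>2)) I"
    by (rule indep_vars_compose2[OF ind]) simp
  have int: "integrable M (\<lambda>\<omega>. exp (s * (Z i \<omega>)\<^sup>2))" if "i \<in> I" for i
    using exp_square_moment(1)[OF Z[OF that] s] .
  have eq: "exp (s * (\<Sum>i\<in>I. (Z i \<omega>)\<^sup>2)) = (\<Prod>i\<in>I. exp (s * (Z i \<omega>)\<^sup>2))" for \<omega>
    using I by (simp add: exp_sum sum_distrib_left)
  have int': "integrable M (\<lambda>\<omega>. exp (s * (\<Sum>i\<in>I. (Z i \<omega>)\<^sup>2)))"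
    unfolding eq by (rule indep_vars_integrable[OF I(1) ind' int])
  have "prob {\<omega> \<in> space M. u \<le> s * (\<Sum>i\<in>I. (Z i \<omega>)\<^sup>2)}
      = prob {\<omega> \<in> space M. exp u \<le> exp (s * (\<Sum>i\<in>I. (Z i \<omega>)\<^sup>2))}"
    by simp
  also have "\<dots> \<le> expectation (\<lambda>\<omega>. exp (s * (\<Sum>i\<in>I. (Z i \<omega>)\<^sup>2))) / exp u"
    by (rule integral_Markov_inequality_measure[OF int', where A = "{}"]) auto
  also have "expectation (\<lambda>\<omega>. exp (s * (\<Sum>i\<in>I. (Z i \<omega>)\<^sup>2)))
      = (\<Prod>i\<in>I. expectation (\<lambda>\<omega>. exp (s * (Z i \<omega>)\<^sup>2)))"
    unfolding eq by (rule indep_vars_lebesgue_integral[OF I(1) ind' int])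
  also have "\<dots> = (1 / sqrt (1 - 2 * s)) ^ card I"
    using exp_square_moment(2)[OF Z s] by simp
  finally show ?thesis by (simp add: exp_minus field_simps)
qed

text \<open>After removing the mean factor \<open>exp s\<close>, the moment generating function of a squared normal is
  sub-Gaussian near 0; deviations of moderate size therefore behave as for bounded variables.\<close>

lemma exp_square_moment_bound:
  fixes s :: real assumes "\<bar>s\<bar> \<le> 1/4"
  shows "1 / sqrt (1 - 2 * s) \<le> exp (s + 4 * s\<^sup>2)"
proof -
  have pos: "1 - 2 * s > 0" using assms by auto
  have "\<bar>ln (1 + - (2 * s)) - - (2 * s)\<bar> \<le> 2 * (- (2 * s))\<^sup>2"
    using assms by (intro abs_ln_one_plus_x_minus_x_bound) (simp add: abs_if split: if_splits)
  then have "- (2 * s) - 8 * s\<^sup>2 \<le> ln (1 - 2 * s)"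
    by (simp add: power2_eq_square abs_le_iff)
  moreover have "1 / sqrt (1 - 2 * s) = exp (- (ln (1 - 2 * s) / 2))"
    using pos by (simp add: exp_minus ln_sqrt[symmetric] field_simps)
  ultimately show ?thesis by simp
qed

text \<open>This is \<open>n - 1\<close> times the sample variance.\<close>

definition centered_ss :: "nat \<Rightarrow> (nat \<Rightarrow> real) \<Rightarrow> real" where
  "centered_ss n y = (\<Sum>k<n. (y k - (\<Sum>l<n. y l) / real n)\<^sup>2)"

lemma centered_ss_eq:
  assumes "n > 0"
  shows "centered_ss n y = (\<Sum>k<n. (y k)\<^sup>2) - ((\<Sum>k<n. y k) / sqrt (real n))\<^sup>2"
proof -
  let ?s = "\<Sum>k<n. y k"
  have "centered_ss n y = (\<Sum>k<n. (y k)\<^sup>2 - 2 * (?s / n) * y k + (?s / n)\<^sup>2)"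
    unfolding centered_ss_def by (intro sum.cong) (auto simp: power2_diff)
  also have "\<dots> = (\<Sum>k<n. (y k)\<^sup>2) - 2 * (?s / n) * ?s + n * (?s / n)\<^sup>2"
    by (simp add: sum.distrib sum_subtractf sum_distrib_left)
  also have "\<dots> = (\<Sum>k<n. (y k)\<^sup>2) - (?s / sqrt n)\<^sup>2"
    using assms by (simp add: power_divide power2_eq_square field_simps)
  finally show ?thesis .
qed

lemma centered_ss_affine:
  assumes "n > 0"
  shows "centered_ss n (\<lambda>k. (y k - a) / c) = centered_ss n y / c\<^sup>2"
proof -
  have "(\<Sum>l<n. (y l - a) / c) / real n = ((\<Sum>l<n. y l) / n - a) / c"
    using assms by (simp add: sum_divide_distrib[symmetric] sum_subtractf diff_divide_distrib)
  then show ?thesis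
    unfolding centered_ss_def sum_divide_distrib
    by (intro sum.cong) (auto simp: power_divide[symmetric] diff_divide_distrib[symmetric])
qed

text \<open>In the difference of two observations the unknown mean cancels. Disjoint pairs thus give
  \<open>n div 2\<close> independent normal differences, which is enough for a small ball bound with an exponent of
  order \<open>n\<close> and replaces the exact chi-square law with \<open>n - 1\<close> degrees of freedom.\<close>

lemma centered_ss_ge_pair_differences:
  "(\<Sum>j<n div 2. ((y (2 * j) - y (2 * j + 1)) / sqrt 2)\<^sup>2) \<le> centered_ss n y"
proof -
  define c where "c = (\<Sum>l<n. y l) / real n"
  have pair: "((a - b) / sqrt 2)\<^sup>2 \<le> (a - c)\<^sup>2 + (b - c)\<^sup>2" for a b :: real
    using zero_le_power2[of "a + b - 2 * c"]
    by (simp add: power_divide power2_eq_square field_simps)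
  have "(\<Sum>j<m. ((y (2 * j) - y (2 * j + 1)) / sqrt 2)\<^sup>2) \<le> (\<Sum>k<2*m. (y k - c)\<^sup>2)" for m
    by (induction m) (use pair in \<open>auto simp: add.assoc intro!: add_mono\<close>)
  also have "(\<Sum>k<2*(n div 2). (y k - c)\<^sup>2) \<le> (\<Sum>k<n. (y k - c)\<^sup>2)"
    by (intro sum_mono2) auto
  finally show ?thesis by (simp add: centered_ss_def c_def)
qed

text \<open>The constant results from the Chernoff parameter \<open>\<rho> / (4 sqrt A)\<close>, where \<open>\<rho>\<^sup>2 = L / n \<le> A\<close>.
  This parameter is proportional to \<open>\<rho>\<close> and at most \<open>1/4\<close>, as \<open>exp_square_moment_bound\<close> demands.\<close>

definition dev_const :: "real \<Rightarrow> real" where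
  "dev_const A = 2 / sqrt A + 64 * sqrt A + 2"

text \<open>The centred sum of squares is \<open>Q - W\<^sup>2\<close> with \<open>Q\<close> the sum of squares and \<open>W\<close> the normalised sum,
  which is again standard normal. The deviation of \<open>Q\<close> from \<open>n\<close> is of order \<open>n \<rho>\<close> by the Chernoff bound;
  the correction \<open>W\<^sup>2\<close> is at most \<open>16 L\<close>, which is \<open>O(n \<rho>)\<close> because \<open>L = n \<rho>\<^sup>2\<close> and \<open>\<rho>\<close> is bounded.\<close>

lemma (in prob_space) std_normal_centered_ss_deviation:
  fixes L A :: real
  assumes n: "n \<ge> 2" and ind: "indep_vars (\<lambda>_. borel) Z {..<n}"
    and Z: "\<And>k. k < n \<Longrightarrow> distributed M lborel (Z k) std_normal_density"
    and L: "1 \<le> L" "L \<le> A * n"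
  shows "prob {\<omega> \<in> space M. \<bar>centered_ss n (\<lambda>k. Z k \<omega>) / (real n - 1) - 1\<bar>
           > dev_const A * sqrt (L / n)} \<le> 4 * exp (- 4 * L)"
proof -
  have A: "A > 0" using L n by (smt (verit) mult_nonpos_nonneg of_nat_0_le_iff)
  have I: "finite {..<n}" "{..<n} \<noteq> {}" using n by (auto simp: lessThan_empty_iff)
  have rv [measurable]: "Z k \<in> borel_measurable M" if "k < n" for k
    using Z[OF that] by (auto simp: distributed_def)
  define \<rho> where "\<rho> = sqrt (L / n)"
  have rho: "\<rho> > 0" "L = n * \<rho>\<^sup>2" "\<rho> \<le> sqrt A"
    using L n by (auto simp: \<rho>_def pos_divide_le_eq)
  define s where "s = \<rho> / (4 * sqrt A)"
  have s: "s > 0" "s \<le> 1/4" using rho A by (auto simp: s_def)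
  define W where "W \<omega> = (\<Sum>k<n. Z k \<omega>) / sqrt (real n)" for \<omega>
  define Q where "Q \<omega> = (\<Sum>k<n. (Z k \<omega>)\<^sup>2)" for \<omega>
  \<comment> \<open>The first summand cancels the quadratic term of the moment bound and leaves exp (- 4 L).\<close>
  define u where "u = 4 * n * s\<^sup>2 + 4 * L"
  have [measurable]: "W \<in> borel_measurable M" "Q \<in> borel_measurable M"
    unfolding W_def Q_def by (auto intro!: borel_measurable_divide borel_measurable_sum)

  have tail: "prob {\<omega> \<in> space M. r * n + u \<le> r * Q \<omega>} \<le> exp (- 4 * L)"
    if r: "\<bar>r\<bar> = s" for r :: real
  proof -
    have "prob {\<omega> \<in> space M. r * n + u \<le> r * Q \<omega>}
        \<le> exp (- (r * n + u)) * (1 / sqrt (1 - 2 * r)) ^ card {..<n}"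
      unfolding Q_def by (rule chernoff_sum_squares[OF I ind Z]) (use r s in auto)
    also have "\<dots> \<le> exp (- (r * n + u)) * exp (r + 4 * r\<^sup>2) ^ n"
      using exp_square_moment_bound[of r] r s by (auto intro!: mult_left_mono power_mono)
    also have "\<dots> = exp (- 4 * L)"
      using r by (auto simp: exp_of_nat_mult[symmetric] exp_add[symmetric] u_def field_simps abs_if split: if_splits)
    finally show ?thesis .
  qed

  have "distributed M lborel (\<lambda>x. \<Sum>k<n. Z k x) (normal_density (\<Sum>k<n. 0) (sqrt (\<Sum>k<n. 1\<^sup>2)))"
    by (rule sum_indep_normal[OF I ind]) (use Z in auto)
  then have W: "distributed M lborel W std_normal_density"
    using n normal_standard_normal_convert[of "sqrt n" "\<lambda>x. \<Sum>k<n. Z k x" 0]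
    by (simp add: W_def[abs_def])
  have tailW: "prob {\<omega> \<in> space M. 4 * L \<le> 1/4 * (W \<omega>)\<^sup>2} \<le> 2 * exp (- 4 * L)"
  proof -
    have "prob {\<omega> \<in> space M. 4 * L \<le> 1/4 * (W \<omega>)\<^sup>2}
        = prob {\<omega> \<in> space M. exp (4 * L) \<le> exp (1/4 * (W \<omega>)\<^sup>2)}"
      by simp
    also have "\<dots> \<le> expectation (\<lambda>\<omega>. exp (1/4 * (W \<omega>)\<^sup>2)) / exp (4 * L)"
      by (rule integral_Markov_inequality_measure[where A = "{}"])
        (use exp_square_moment(1)[OF W, of "1/4"] in auto)
    also have "expectation (\<lambda>\<omega>. exp (1/4 * (W \<omega>)\<^sup>2)) = sqrt 2"
      using exp_square_moment(2)[OF W, of "1/4"] by (simp add: real_sqrt_divide)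
    also have "sqrt 2 / exp (4 * L) \<le> 2 * exp (- 4 * L)"
      using sqrt2_less_2 by (simp add: exp_minus field_simps)
    finally show ?thesis .
  qed

  let ?E = "\<lambda>r::real. {\<omega> \<in> space M. r * n + u \<le> r * Q \<omega>}"
  let ?F = "{\<omega> \<in> space M. 4 * L \<le> 1/4 * (W \<omega>)\<^sup>2}"
  have "{\<omega> \<in> space M. \<bar>centered_ss n (\<lambda>k. Z k \<omega>) / (real n - 1) - 1\<bar> > dev_const A * \<rho>}
      \<subseteq> ?E s \<union> ?E (- s) \<union> ?F"
  proof (rule ccontr)
    assume "\<not> ?thesis"
    then obtain \<omega> where w: "\<bar>centered_ss n (\<lambda>k. Z k \<omega>) / (real n - 1) - 1\<bar> > dev_const A * \<rho>"
      "s * Q \<omega> < s * n + u" "- s * Q \<omega> < - s * n + u" "(W \<omega>)\<^sup>2 < 16 * L"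
      by fastforce
    have us: "u / s = n * \<rho> * (1 / sqrt A + 16 * sqrt A)"
      using A rho s unfolding u_def s_def
      by (simp add: power2_eq_square power_divide field_simps)
    have "s * (Q \<omega> - n) < u" "s * (n - Q \<omega>) < u"
      using w(2,3) by (auto simp: algebra_simps)
    then have q: "\<bar>Q \<omega> - n\<bar> < u / s"
      using s by (auto simp: abs_less_iff pos_less_divide_eq mult.commute)
    have one: "1 \<le> n * \<rho>"
    proof -
      have "1 \<le> n * L" using n L by (smt (verit) mult_le_cancel_left1 of_nat_1 of_nat_le_iff numeral_le_iff one_le_numeral order_trans)
      also have "\<dots> = (n * \<rho>)\<^sup>2" using rho by (simp add: power2_eq_square)
      finally show ?thesis using rho power2_le_imp_le[of 1 "n * \<rho>"] by simp
    qed
    have L': "L \<le> n * \<rho> * sqrt A"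
      using rho n by (simp add: power2_eq_square)
    have n1: "real n - 1 > 0" "real n \<le> 2 * (real n - 1)" using n by auto
    have eq: "centered_ss n (\<lambda>k. Z k \<omega>) / (real n - 1) - 1
        = (Q \<omega> - n - (W \<omega>)\<^sup>2 + 1) / (real n - 1)"
      using n n1 by (simp add: centered_ss_eq Q_def W_def field_simps)
    have "\<bar>Q \<omega> - n - (W \<omega>)\<^sup>2 + 1\<bar> \<le> u / s + 16 * L + 1"
      using q w(4) by (smt (verit) zero_le_power2)
    also have "\<dots> \<le> n * \<rho> * (1 / sqrt A + 16 * sqrt A) + 16 * (n * \<rho> * sqrt A) + n * \<rho>"
      using us one L' by simp
    also have "\<dots> = n * (\<rho> * dev_const A / 2)"
      by (simp add: dev_const_def field_simps)
    also have "\<dots> \<le> 2 * (real n - 1) * (\<rho> * dev_const A / 2)"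
      using rho A n1 by (intro mult_right_mono) (auto simp: dev_const_def)
    finally have "\<bar>Q \<omega> - n - (W \<omega>)\<^sup>2 + 1\<bar> / (real n - 1) \<le> dev_const A * \<rho>"
      using n1 by (simp add: field_simps)
    then show False using w(1) n1 by (simp add: eq)
  qed
  then have "prob {\<omega> \<in> space M. \<bar>centered_ss n (\<lambda>k. Z k \<omega>) / (real n - 1) - 1\<bar> > dev_const A * \<rho>}
      \<le> prob (?E s \<union> ?E (- s) \<union> ?F)"
    by (intro finite_measure_mono) auto
  also have "\<dots> \<le> prob (?E s) + prob (?E (- s)) + prob ?F"
    by (intro order_trans[OF measure_Un_le] add_right_mono measure_Un_le) auto
  also have "\<dots> \<le> exp (- 4 * L) + exp (- 4 * L) + 2 * exp (- 4 * L)"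
    using s tail[of s] tail[of "- s"] tailW by (intro add_mono) auto
  finally show ?thesis by (simp add: \<rho>_def)
qed

text \<open>With this threshold \<open>t\<close>, the Chernoff bound at parameter \<open>- 1 / t\<close> contributes at most the factor
  \<open>exp 1 * sqrt (t / 2) = exp (- B)\<close> for each pair of observations.\<close>

definition small_ball_const :: "real \<Rightarrow> real" where
  "small_ball_const B = 2 * exp (- 2 * (1 + B))"

text \<open>The exponent \<open>B\<close> is free: a small enough threshold makes the failure probability smaller than
  any given exponential in \<open>n\<close>, so that it survives a union over exponentially many vectors.\<close>

lemma (in prob_space) std_normal_centered_ss_small_ball:
  assumes n: "n \<ge> 2" and ind: "indep_vars (\<lambda>_. borel) Z {..<n}"
    and Z: "\<And>k. k < n \<Longrightarrow> distributed M lborel (Z k) std_normal_density"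
  shows "prob {\<omega> \<in> space M. centered_ss n (\<lambda>k. Z k \<omega>) \<le> small_ball_const B * (n div 2)}
           \<le> exp (- B * (n div 2))"
proof -
  let ?m = "n div 2"
  define D where "D j \<omega> = (Z (2 * j) \<omega> - Z (2 * j + 1) \<omega>) / sqrt 2" for j \<omega>
  define t where "t = small_ball_const B"
  have t: "t > 0" by (simp add: t_def small_ball_const_def)
  have rv [measurable]: "Z k \<in> borel_measurable M" if "k < n" for k
    using Z[OF that] by (auto simp: distributed_def)
  have m: "finite {..<?m}" "{..<?m} \<noteq> {}" using n by (auto simp: lessThan_empty_iff)
  have "indep_vars (\<lambda>j. PiM {2 * j, 2 * j + 1} (\<lambda>_. borel))
      (\<lambda>j \<omega>. restrict (\<lambda>i. Z i \<omega>) {2 * j, 2 * j + 1}) {..<?m}"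
  proof (rule indep_vars_restrict[OF ind])
    show "{2 * j, 2 * j + 1} \<subseteq> {..<n}" if "j \<in> {..<?m}" for j using that by auto
    show "disjoint_family_on (\<lambda>j. {2 * j, 2 * j + 1}) {..<?m}"
      unfolding disjoint_family_on_def
    proof (intro ballI impI)
      fix a b :: nat assume "a \<noteq> b"
      then have "2 * a \<noteq> 2 * b" "2 * a + 1 \<noteq> 2 * b" "2 * a \<noteq> 2 * b + 1" by presburger+
      then show "{2 * a, 2 * a + 1} \<inter> {2 * b, 2 * b + 1} = {}" by auto
    qed
  qed
  then have "indep_vars (\<lambda>_. borel)
      (\<lambda>j \<omega>. (\<lambda>x. (x (2 * j) - x (2 * j + 1)) / sqrt 2) (restrict (\<lambda>i. Z i \<omega>) {2 * j, 2 * j + 1})) {..<?m}"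
    by (rule indep_vars_compose2) auto
  then have indD: "indep_vars (\<lambda>_. borel) D {..<?m}"
    by (simp add: D_def[abs_def])
  have D: "distributed M lborel (D j) std_normal_density" if "j < ?m" for j
  proof -
    have j: "2 * j < n" "2 * j + 1 < n" using that by auto
    have "indep_var borel (Z (2 * j)) borel (Z (2 * j + 1))"
      using indep_vars_sum[of "{2 * j + 1}" "2 * j" Z] indep_vars_subset[OF ind, of "{2 * j, 2 * j + 1}"] j
      by auto
    from diff_indep_normal[OF this, of 1 1 0 0]
    have "distributed M lborel (\<lambda>x. Z (2 * j) x - Z (2 * j + 1) x) (normal_density 0 (sqrt 2))"
      using Z j by simp
    then show ?thesis
      using normal_standard_normal_convert[of "sqrt 2" "\<lambda>x. Z (2 * j) x - Z (2 * j + 1) x" 0]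
      by (simp add: D_def[abs_def])
  qed
  have "{\<omega> \<in> space M. centered_ss n (\<lambda>k. Z k \<omega>) \<le> t * ?m}
      \<subseteq> {\<omega> \<in> space M. - real ?m \<le> (- (1 / t)) * (\<Sum>j<?m. (D j \<omega>)\<^sup>2)}"
  proof safe
    fix \<omega> assume "centered_ss n (\<lambda>k. Z k \<omega>) \<le> t * ?m"
    then have "(\<Sum>j<?m. (D j \<omega>)\<^sup>2) \<le> t * ?m"
      using centered_ss_ge_pair_differences[of "\<lambda>k. Z k \<omega>" n] by (simp add: D_def)
    then show "- real ?m \<le> (- (1 / t)) * (\<Sum>j<?m. (D j \<omega>)\<^sup>2)"
      using t by (simp add: field_simps)
  qed
  moreover have [measurable]: "D j \<in> borel_measurable M" if "j < ?m" for j
    using D[OF that] by (auto simp: distributed_def)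
  ultimately have "prob {\<omega> \<in> space M. centered_ss n (\<lambda>k. Z k \<omega>) \<le> t * ?m}
      \<le> prob {\<omega> \<in> space M. - real ?m \<le> (- (1 / t)) * (\<Sum>j<?m. (D j \<omega>)\<^sup>2)}"
    by (intro finite_measure_mono) auto
  also have "\<dots> \<le> exp (- (- real ?m)) * (1 / sqrt (1 - 2 * (- (1 / t)))) ^ card {..<?m}"
  proof (rule chernoff_sum_squares[OF m indD D])
    have "0 < 1 / t" using t by simp
    then show "- (1 / t) < 1 / 2" by linarith
  qed auto
  also have "\<dots> \<le> exp (real ?m) * exp (- (1 + B)) ^ ?m"
  proof -
    have "sqrt (2 / t) = exp (1 + B)"
      by (rule real_sqrt_unique)
        (auto simp: t_def small_ball_const_def exp_minus power2_eq_square exp_add[symmetric] field_simps)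
    moreover have "2 / t > 0" using t by simp
    moreover have "sqrt (2 / t) \<le> sqrt (1 - 2 * (- (1 / t)))" by simp
    ultimately have "1 / sqrt (1 - 2 * (- (1 / t))) \<le> 1 / exp (1 + B)"
      using \<open>2 / t > 0\<close> by (intro divide_left_mono mult_pos_pos real_sqrt_gt_zero) (linarith | simp)+
    also have "\<dots> = exp (- (1 + B))" by (simp only: exp_minus inverse_eq_divide)
    finally show ?thesis
      using t by (simp only: minus_minus card_lessThan) (intro mult_left_mono power_mono, auto)
  qed
  also have "\<dots> = exp (- B * ?m)"
    by (simp add: exp_of_nat_mult[symmetric] exp_add[symmetric] algebra_simps)
  finally show ?thesis by (simp add: t_def)
qed

section \<open>Eigenvalue bounds for symmetric quadratic forms\<close>

text \<open>Vectors of variable dimension \<open>d\<close> carry no topology; functions that vanish from \<open>d\<close> on represent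
  them, and the sphere is a closed subset of a product of compact intervals.\<close>

lemma unit_sphere_compact:
  "compact {x::nat \<Rightarrow> real. (\<forall>j\<ge>d. x j = 0) \<and> (\<Sum>j<d. (x j)\<^sup>2) = 1}" (is "compact ?S")
proof -
  let ?K = "\<Pi>\<^sub>E j\<in>(UNIV :: nat set). {-1..1::real}"
  have "compactin (product_topology (\<lambda>_::nat. euclidean) UNIV) ?K"
    by (subst compactin_PiE) auto
  then have K: "compact ?K" by (simp add: euclidean_product_topology)
  have c: "continuous_on UNIV (\<lambda>x::nat \<Rightarrow> real. x j)" for j
    by (rule continuous_on_product_coordinates)
  have "?S = {x. \<forall>j. j \<ge> d \<longrightarrow> x j = 0} \<inter> {x. (\<Sum>j<d. (x j)\<^sup>2) = 1}" by auto
  also have "closed \<dots>"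
    by (intro closed_Int closed_Collect_all closed_Collect_imp open_Collect_const closed_Collect_eq
        continuous_intros c)
  finally have cl: "closed ?S" .
  have "?S \<subseteq> ?K"
  proof
    fix x assume x: "x \<in> ?S"
    have "\<bar>x j\<bar> \<le> 1" for j
    proof (cases "j < d")
      case True
      then have "(x j)\<^sup>2 \<le> (\<Sum>j<d. (x j)\<^sup>2)" by (intro member_le_sum) auto
      then show ?thesis using x by (simp add: abs_square_le_1)
    qed (use x in auto)
    then show "x \<in> ?K" by (auto simp: PiE_def extensional_def abs_le_iff minus_le_iff)
  qed
  then show ?thesis using compact_Int_closed[OF K cl] by (simp add: Int_absorb1)
qed

lemma quadratic_form_eq_sum:
  fixes A :: "real mat"
  assumes "A \<in> carrier_mat d d" "v \<in> carrier_vec d" "w \<in> carrier_vec d"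
  shows "v \<bullet> (A *\<^sub>v w) = (\<Sum>i<d. \<Sum>j<d. A $$ (i, j) * v $ i * w $ j)"
  using assms
  by (auto simp: scalar_prod_def sum_distrib_left atLeast0LessThan algebra_simps intro!: sum.cong)

lemma scalar_prod_self_nonneg: "0 \<le> v \<bullet> (v :: real vec)"
  by (auto simp: scalar_prod_def intro!: sum_nonneg)

lemma scalar_prod_self_eq_0:
  assumes "v \<in> carrier_vec d" "v \<bullet> (v :: real vec) = 0"
  shows "v = 0\<^sub>v d"
  using assms by (intro eq_vecI) (auto simp: scalar_prod_def sum_nonneg_eq_0_iff)

lemma symmetric_form_comm:
  fixes A :: "real mat"
  assumes A: "A \<in> carrier_mat d d" "transpose_mat A = A"
    and "v \<in> carrier_vec d" "w \<in> carrier_vec d"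
  shows "v \<bullet> (A *\<^sub>v w) = w \<bullet> (A *\<^sub>v v)"
  using transpose_vec_mult_scalar[of A d d w v] assms
  by (simp add: comm_scalar_prod[of _ d])

lemma exists_minimal_rayleigh_quotient:
  fixes A :: "real mat"
  assumes A: "A \<in> carrier_mat d d" and d: "d > 0"
  shows "\<exists>x l. x \<in> carrier_vec d \<and> x \<bullet> x = 1 \<and> x \<bullet> (A *\<^sub>v x) = l \<and>
           (\<forall>v \<in> carrier_vec d. l * (v \<bullet> v) \<le> v \<bullet> (A *\<^sub>v v))"
proof -
  define S where "S = {x::nat \<Rightarrow> real. (\<forall>j\<ge>d. x j = 0) \<and> (\<Sum>j<d. (x j)\<^sup>2) = 1}"
  define F where "F x = (\<Sum>i<d. \<Sum>j<d. A $$ (i, j) * x i * x j)" for x :: "nat \<Rightarrow> real"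
  have F: "F (\<lambda>j. if j < d then v $ j else 0) = v \<bullet> (A *\<^sub>v v)" if "v \<in> carrier_vec d" for v
    unfolding quadratic_form_eq_sum[OF A that that] F_def by (auto intro!: sum.cong)
  have c: "continuous_on S (\<lambda>x. x j)" for j
    by (rule continuous_on_subset[OF continuous_on_product_coordinates]) simp
  have "compact S" unfolding S_def by (rule unit_sphere_compact)
  moreover have "(\<lambda>j. if j = 0 then 1 else 0) \<in> S"
  proof -
    have "(\<Sum>j<d. (if j = 0 then 1 else 0 :: real)\<^sup>2) = (\<Sum>j<d. if j = 0 then 1 else 0)"
      by (intro sum.cong) auto
    then show ?thesis using d by (simp add: S_def)
  qed
  then have "S \<noteq> {}" by auto
  moreover have "continuous_on S F"
    unfolding F_def by (intro continuous_intros c)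
  ultimately have "\<exists>y\<in>S. \<forall>z\<in>S. F y \<le> F z" by (rule continuous_attains_inf)
  then obtain y where y: "y \<in> S" "\<And>z. z \<in> S \<Longrightarrow> F y \<le> F z" by blast
  define x where "x = vec d y"
  have x: "x \<in> carrier_vec d" by (simp add: x_def)
  have "(\<lambda>j. if j < d then x $ j else 0) = y"
    using y(1) by (auto simp: x_def S_def fun_eq_iff)
  with F[OF x] have Fy: "F y = x \<bullet> (A *\<^sub>v x)" by simp
  have xx: "x \<bullet> x = 1"
    using y(1) by (simp add: x_def S_def scalar_prod_def atLeast0LessThan power2_eq_square)
  have "F y * (v \<bullet> v) \<le> v \<bullet> (A *\<^sub>v v)" if v: "v \<in> carrier_vec d" for v
  proof (cases "v \<bullet> v = 0")
    case True
    then have "v = 0\<^sub>v d" using scalar_prod_self_eq_0 v by blast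
    then show ?thesis using A True by (simp add: mult_mat_vec_def)
  next
    case False
    define r where "r = sqrt (v \<bullet> v)"
    have r: "r > 0" "r\<^sup>2 = v \<bullet> v"
      using False scalar_prod_self_nonneg[of v] by (auto simp: r_def)
    define w where "w = (1 / r) \<cdot>\<^sub>v v"
    have w: "w \<in> carrier_vec d" using v by (simp add: w_def)
    have "w \<bullet> w = (1 / r) * ((1 / r) * (v \<bullet> v))" using v by (simp add: w_def)
    also have "\<dots> = 1" unfolding r(2)[symmetric] using r(1) by (simp add: power2_eq_square)
    finally have ww: "w \<bullet> w = 1" .
    have "(\<Sum>j<d. (w $ j)\<^sup>2) = 1"
      using ww w by (simp add: scalar_prod_def atLeast0LessThan power2_eq_square)
    then have "(\<lambda>j. if j < d then w $ j else 0) \<in> S" by (simp add: S_def)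
    from y(2)[OF this] have "F y \<le> w \<bullet> (A *\<^sub>v w)" by (simp only: F[OF w])
    also have "\<dots> = (1 / r) * ((1 / r) * (v \<bullet> (A *\<^sub>v v)))"
      unfolding w_def using v A by (simp add: mult_mat_vec[OF A])
    also have "\<dots> = (v \<bullet> (A *\<^sub>v v)) / (v \<bullet> v)"
      unfolding r(2)[symmetric] using r(1) by (simp add: power2_eq_square)
    finally show ?thesis
      using False scalar_prod_self_nonneg[of v] by (simp add: pos_le_divide_eq)
  qed
  then show ?thesis using x xx Fy[symmetric] by (intro exI[of _ x] exI[of _ "F y"]) simp
qed

text \<open>At a unit vector \<open>x\<close> that minimises the Rayleigh quotient with value \<open>l\<close>, the residual
  \<open>r = A x - l x\<close> vanishes: the form \<open>A - l\<close> is nonnegative and is 0 at \<open>x\<close>, so along \<open>x - e r\<close> its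
  first-order decrease \<open>2 e |r|\<^sup>2\<close> must be dominated by a term of order \<open>e\<^sup>2\<close>.\<close>

lemma symmetric_min_eigenvalue:
  fixes A :: "real mat"
  assumes A: "A \<in> carrier_mat d d" and sym: "transpose_mat A = A" and d: "d > 0"
  shows "\<exists>l. eigenvalue A l \<and> (\<forall>v \<in> carrier_vec d. l * (v \<bullet> v) \<le> v \<bullet> (A *\<^sub>v v))"
proof -
  obtain x l where x: "x \<in> carrier_vec d" "x \<bullet> x = 1" "x \<bullet> (A *\<^sub>v x) = l"
    and min: "\<And>v. v \<in> carrier_vec d \<Longrightarrow> l * (v \<bullet> v) \<le> v \<bullet> (A *\<^sub>v v)"
    using exists_minimal_rayleigh_quotient[OF A d] by blast
  define r where "r = A *\<^sub>v x + (- l) \<cdot>\<^sub>v x"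
  have Ax: "A *\<^sub>v x \<in> carrier_vec d" using A x by auto
  have r: "r \<in> carrier_vec d" using Ax x by (simp add: r_def)
  define g where "g = r \<bullet> (A *\<^sub>v r) - l * (r \<bullet> r)"
  have rr: "r \<bullet> r = r \<bullet> (A *\<^sub>v x) - l * (r \<bullet> x)"
    using r x Ax by (subst (2) r_def) (simp add: scalar_prod_add_distrib[of _ d])
  have expand: "2 * e * (r \<bullet> r) \<le> e * e * g" for e
  proof -
    define v where "v = x + (- e) \<cdot>\<^sub>v r"
    have er: "(- e) \<cdot>\<^sub>v r \<in> carrier_vec d" using r by simp
    have v: "v \<in> carrier_vec d" using x er by (simp add: v_def)
    have "v \<bullet> (A *\<^sub>v v) = l - 2 * e * (r \<bullet> (A *\<^sub>v x)) + e * e * (r \<bullet> (A *\<^sub>v r))"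
      unfolding v_def using A x r er Ax symmetric_form_comm[OF A sym x(1) r]
      by (simp add: mult_add_distrib_mat_vec[OF A] mult_mat_vec[OF A]
          scalar_prod_add_distrib[of _ d] add_scalar_prod_distrib[of _ d] algebra_simps)
    moreover have "v \<bullet> v = 1 - 2 * e * (r \<bullet> x) + e * e * (r \<bullet> r)"
      unfolding v_def using x r er comm_scalar_prod[OF x(1) r]
      by (simp add: scalar_prod_add_distrib[of _ d] add_scalar_prod_distrib[of _ d] algebra_simps)
    ultimately have "l * (1 - 2 * e * (r \<bullet> x) + e * e * (r \<bullet> r))
        \<le> l - 2 * e * (r \<bullet> (A *\<^sub>v x)) + e * e * (r \<bullet> (A *\<^sub>v r))"
      using min[OF v] by simp
    moreover have "r \<bullet> (A *\<^sub>v x) = r \<bullet> r + l * (r \<bullet> x)" using rr by simp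
    ultimately show ?thesis by (simp add: g_def algebra_simps)
  qed
  have g: "g \<ge> 0" using min[OF r] by (simp add: g_def)
  have "r \<bullet> r = 0"
  proof (rule ccontr)
    assume "r \<bullet> r \<noteq> 0"
    then have pos: "r \<bullet> r > 0" using scalar_prod_self_nonneg[of r] by auto
    \<comment> \<open>Small enough for the quadratic term to lose against the linear one.\<close>
    define e where "e = (r \<bullet> r) / (g + 1)"
    have e: "e > 0" using pos g by (simp add: e_def)
    have "2 * (r \<bullet> r) \<le> e * g" using expand[of e] e by (simp add: mult.assoc mult.left_commute)
    also have "\<dots> \<le> r \<bullet> r" using g pos by (simp add: e_def field_simps)
    finally show False using pos by simp
  qed
  then have r0: "r = 0\<^sub>v d" using scalar_prod_self_eq_0 r by blast
  have "A *\<^sub>v x = l \<cdot>\<^sub>v x"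
  proof (rule eq_vecI)
    fix j assume j: "j < dim_vec (l \<cdot>\<^sub>v x)"
    then have "r $ j = 0" using r0 x by simp
    then show "(A *\<^sub>v x) $ j = (l \<cdot>\<^sub>v x) $ j" using j x Ax by (simp add: r_def)
  qed (use A x in auto)
  moreover have "x \<noteq> 0\<^sub>v d" using x by auto
  ultimately have "eigenvalue A l" using A x by (auto simp: eigenvalue_def eigenvector_def)
  with min show ?thesis by blast
qed

text \<open>The largest eigenvalue is controlled through the smallest eigenvalue of \<open>- A\<close>.\<close>

lemma symmetric_form_eigenvalue_bounds:
  fixes A :: "real mat"
  assumes A: "A \<in> carrier_mat d d" and sym: "transpose_mat A = A" and d: "d > 0"
    and ev: "\<And>l. eigenvalue A l \<Longrightarrow> a \<le> l \<and> l \<le> b" and v: "v \<in> carrier_vec d"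
  shows "a * (v \<bullet> v) \<le> v \<bullet> (A *\<^sub>v v)" "v \<bullet> (A *\<^sub>v v) \<le> b * (v \<bullet> v)"
proof -
  obtain l where l: "eigenvalue A l" "l * (v \<bullet> v) \<le> v \<bullet> (A *\<^sub>v v)"
    using symmetric_min_eigenvalue[OF A sym d] v by blast
  have "a * (v \<bullet> v) \<le> l * (v \<bullet> v)"
    using ev[OF l(1)] scalar_prod_self_nonneg by (intro mult_right_mono) auto
  then show "a * (v \<bullet> v) \<le> v \<bullet> (A *\<^sub>v v)" using l by simp
  have neg: "(- A) *\<^sub>v w = - (A *\<^sub>v w)" if "w \<in> carrier_vec d" for w
    using A that by (intro eq_vecI) (auto simp: uminus_scalar_prod[symmetric])
  have "A $$ (j, i) = A $$ (i, j)" if "i < d" "j < d" for i j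
  proof -
    have "transpose_mat A $$ (i, j) = A $$ (j, i)" using A that by (intro index_transpose_mat(1)) auto
    then show ?thesis unfolding sym by simp
  qed
  then have "- A \<in> carrier_mat d d" "transpose_mat (- A) = - A"
    using A by (auto intro!: eq_matI)
  then obtain k where k: "eigenvalue (- A) k" "k * (v \<bullet> v) \<le> v \<bullet> ((- A) *\<^sub>v v)"
    using symmetric_min_eigenvalue[OF _ _ d, of "- A"] v by blast
  from k(1) obtain x where x: "x \<in> carrier_vec d" "x \<noteq> 0\<^sub>v d" "(- A) *\<^sub>v x = k \<cdot>\<^sub>v x"
    using A by (auto simp: eigenvalue_def eigenvector_def)
  have "A *\<^sub>v x = (- k) \<cdot>\<^sub>v x"
  proof (rule eq_vecI)
    fix j assume j: "j < dim_vec ((- k) \<cdot>\<^sub>v x)"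
    have "(- (A *\<^sub>v x)) $ j = (k \<cdot>\<^sub>v x) $ j" using x neg by simp
    moreover have "(- (A *\<^sub>v x)) $ j = - ((A *\<^sub>v x) $ j)"
      using j x(1) A by (intro index_uminus_vec) auto
    ultimately have "- ((A *\<^sub>v x) $ j) = k * x $ j" using j by simp
    then show "(A *\<^sub>v x) $ j = ((- k) \<cdot>\<^sub>v x) $ j"
      using j x by (simp del: index_mult_mat_vec)
  qed (use A x in auto)
  then have "eigenvalue A (- k)" using A x by (auto simp: eigenvalue_def eigenvector_def)
  then have "- k \<le> b" using ev by blast
  then have "(- k) * (v \<bullet> v) \<le> b * (v \<bullet> v)"
    using scalar_prod_self_nonneg by (intro mult_right_mono) auto
  moreover have "v \<bullet> ((- A) *\<^sub>v v) = - (v \<bullet> (A *\<^sub>v v))"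
    using neg[OF v] v A by simp
  ultimately show "v \<bullet> (A *\<^sub>v v) \<le> b * (v \<bullet> v)" using k(2) by simp
qed

text \<open>The form vanishes at every vector of the kernel, so \<open>A\<close> is invertible and \<^const>\<open>mat_inv\<close> takes
  its intended value.\<close>

lemma positive_form_mat_inv:
  fixes A :: "real mat"
  assumes A: "A \<in> carrier_mat d d"
    and pos: "\<And>v. v \<in> carrier_vec d \<Longrightarrow> v \<noteq> 0\<^sub>v d \<Longrightarrow> v \<bullet> (A *\<^sub>v v) > 0"
  shows "mat_inv A \<in> carrier_mat d d" "A * mat_inv A = 1\<^sub>m d"
proof -
  have "det A \<noteq> 0"
  proof
    assume "det A = 0"
    then obtain v where v: "v \<in> carrier_vec d" "v \<noteq> 0\<^sub>v d" "A *\<^sub>v v = 0\<^sub>v d"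
      using det_0_iff_vec_prod_zero_field[OF A] by blast
    then show False using pos[of v] by simp
  qed
  then have "A \<in> Units (ring_mat TYPE(real) d ())" by (rule det_non_zero_imp_unit[OF A])
  then obtain B where "mat_inverse A = Some B" using mat_inverse(1)[OF A, of "()"] by (cases "mat_inverse A") auto
  then show "mat_inv A \<in> carrier_mat d d" "A * mat_inv A = 1\<^sub>m d"
    using mat_inverse(2)[OF A] by (auto simp: mat_inv_def)
qed

section \<open>The estimator as the solution of a block system\<close>

lemma l2_norm_eq: "l2_norm v = L2_set (\<lambda>j. v $ j) {..<dim_vec v}"
  by (simp add: l2_norm_def L2_set_def scalar_prod_def atLeast0LessThan power2_eq_square)

lemma sum_abs_le_l2_norm: "(\<Sum>j<dim_vec v. \<bar>v $ j\<bar>) \<le> sqrt (dim_vec v) * l2_norm v"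
proof -
  have "(\<Sum>j<dim_vec v. \<bar>v $ j\<bar> * \<bar>1\<bar>)
      \<le> L2_set (\<lambda>j. v $ j) {..<dim_vec v} * L2_set (\<lambda>_. 1) {..<dim_vec v}"
    by (rule L2_set_mult_ineq)
  then show ?thesis by (simp add: l2_norm_eq L2_set_constant mult.commute)
qed

lemma col_support_props:
  "distinct (col_support \<Omega> i)"
  "set (col_support \<Omega> i) = {j. j < dim_row \<Omega> \<and> \<Omega> $$ (j, i) \<noteq> 0}"
  by (auto simp: col_support_def)

lemma length_col_support:
  "length (col_support \<Omega> i) = card {j. j < dim_row \<Omega> \<and> \<Omega> $$ (j, i) \<noteq> 0}"
  using distinct_card[OF col_support_props(1)] col_support_props(2) by metis

lemma sel_mat_carrier: "sel_mat \<Omega> i \<in> carrier_mat (dim_row \<Omega>) (length (col_support \<Omega> i))"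
  unfolding sel_mat_def using mat_of_cols_carrier(1)[of "dim_row \<Omega>" "map (unit_vec (dim_row \<Omega>)) (col_support \<Omega> i)"]
  by simp

lemma nz_col_carrier: "nz_col \<Omega> i \<in> carrier_vec (length (col_support \<Omega> i))"
  by (intro carrier_vecI) (simp add: nz_col_def)

lemma sel_mat_index:
  assumes "r < dim_row \<Omega>" "k < length (col_support \<Omega> i)"
  shows "sel_mat \<Omega> i $$ (r, k) = (if col_support \<Omega> i ! k = r then 1 else 0)"
proof -
  have "col_support \<Omega> i ! k < dim_row \<Omega>"
    using nth_mem[OF assms(2)] by (auto simp: col_support_props(2))
  then show ?thesis using assms by (auto simp: sel_mat_def mat_of_cols_index)
qed

lemma sel_mat_mult_vec_support:
  assumes d: "d \<in> carrier_vec (length (col_support \<Omega> i))" and k: "k < length (col_support \<Omega> i)"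
  shows "(sel_mat \<Omega> i *\<^sub>v d) $ (col_support \<Omega> i ! k) = d $ k"
proof -
  let ?l = "col_support \<Omega> i"
  have r: "?l ! k < dim_row \<Omega>"
    using nth_mem[OF k] by (auto simp: col_support_props(2))
  have "(sel_mat \<Omega> i *\<^sub>v d) $ (?l ! k) = (\<Sum>m<length ?l. sel_mat \<Omega> i $$ (?l ! k, m) * d $ m)"
    using r d sel_mat_carrier[of \<Omega> i] by (simp add: scalar_prod_def atLeast0LessThan)
  also have "\<dots> = (\<Sum>m<length ?l. if m = k then d $ m else 0)"
    using r k by (intro sum.cong)
      (auto simp: sel_mat_index nth_eq_iff_index_eq[OF col_support_props(1)])
  also have "\<dots> = d $ k" using k by simp
  finally show ?thesis .
qed

lemma sel_mat_mult_vec_off_support: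
  assumes d: "d \<in> carrier_vec (length (col_support \<Omega> i))"
    and r: "r < dim_row \<Omega>" "r \<notin> set (col_support \<Omega> i)"
  shows "(sel_mat \<Omega> i *\<^sub>v d) $ r = 0"
proof -
  let ?l = "col_support \<Omega> i"
  have "(sel_mat \<Omega> i *\<^sub>v d) $ r = (\<Sum>m<length ?l. sel_mat \<Omega> i $$ (r, m) * d $ m)"
    using r d sel_mat_carrier[of \<Omega> i] by (simp add: scalar_prod_def atLeast0LessThan)
  also have "\<dots> = 0"
    using r nth_mem[of _ ?l] by (intro sum.neutral) (auto simp: sel_mat_index)
  finally show ?thesis .
qed

text \<open>The selection matrix pads a vector with zeros. With \<open>f\<close> the square or the absolute value, this
  says that the padding preserves the Euclidean norm or the 1-norm.\<close>

lemma sum_sel_mat_mult_vec: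
  fixes f :: "real \<Rightarrow> real"
  assumes d: "d \<in> carrier_vec (length (col_support \<Omega> i))" and f: "f 0 = 0"
  shows "(\<Sum>r<dim_row \<Omega>. f ((sel_mat \<Omega> i *\<^sub>v d) $ r)) = (\<Sum>k<length (col_support \<Omega> i). f (d $ k))"
proof -
  let ?l = "col_support \<Omega> i"
  have "(\<Sum>r<dim_row \<Omega>. f ((sel_mat \<Omega> i *\<^sub>v d) $ r)) = (\<Sum>r\<in>set ?l. f ((sel_mat \<Omega> i *\<^sub>v d) $ r))"
    using sel_mat_mult_vec_off_support[OF d] f
    by (intro sum.mono_neutral_right) (auto simp: col_support_props(2))
  also have "\<dots> = (\<Sum>k<length ?l. f ((sel_mat \<Omega> i *\<^sub>v d) $ (?l ! k)))"
    by (rule sum.reindex_bij_betw[symmetric]) (simp add: bij_betw_nth col_support_props(1))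
  also have "\<dots> = (\<Sum>k<length ?l. f (d $ k))"
    using sel_mat_mult_vec_support[OF d] by (intro sum.cong) auto
  finally show ?thesis .
qed

lemma transpose_sel_mat_mult_vec:
  assumes v: "v \<in> carrier_vec (dim_row \<Omega>)" and k: "k < length (col_support \<Omega> i)"
  shows "(transpose_mat (sel_mat \<Omega> i) *\<^sub>v v) $ k = v $ (col_support \<Omega> i ! k)"
proof -
  let ?l = "col_support \<Omega> i"
  have r: "?l ! k < dim_row \<Omega>"
    using nth_mem[OF k] by (auto simp: col_support_props(2))
  have "(transpose_mat (sel_mat \<Omega> i) *\<^sub>v v) $ k = (\<Sum>r<dim_row \<Omega>. sel_mat \<Omega> i $$ (r, k) * v $ r)"
    using v k sel_mat_carrier[of \<Omega> i] by (simp add: scalar_prod_def atLeast0LessThan)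
  also have "\<dots> = (\<Sum>r<dim_row \<Omega>. if r = ?l ! k then v $ r else 0)"
    using k by (intro sum.cong) (auto simp: sel_mat_index)
  also have "\<dots> = v $ (?l ! k)" using r by simp
  finally show ?thesis .
qed

text \<open>The error \<open>d\<close> satisfies \<open>G d = f - G w\<close> for the block \<open>G\<close> of \<open>S\<close>. Since \<open>G w\<close> consists of entries of
  \<open>S\<close> times the full column of \<open>\<Omega>\<close>, the hypothesis on \<open>S *\<^sub>v col \<Omega> i\<close> bounds every entry of
  \<open>G d\<close>, and pairing with \<open>d\<close> gives the bound. The lower bound on the form also makes \<open>G\<close>
  invertible, so that the estimator is not the default value of \<^const>\<open>mat_inv\<close>.\<close>

lemma nz_col_est_error:
  fixes \<Omega> S :: "real mat"
  assumes Om: "\<Omega> \<in> carrier_mat p p" and S: "S \<in> carrier_mat p p" and i: "i < p"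
    and c: "c > 0" and \<rho>: "\<rho> \<ge> 0"
    and res: "\<And>j. j < p \<Longrightarrow> \<bar>(S *\<^sub>v col \<Omega> i) $ j - unit_vec p i $ j\<bar> \<le> \<rho>"
    and low: "\<And>v. v \<in> carrier_vec p \<Longrightarrow> (\<forall>j<p. \<Omega> $$ (j, i) = 0 \<longrightarrow> v $ j = 0) \<Longrightarrow>
      c * (v \<bullet> v) \<le> v \<bullet> (S *\<^sub>v v)"
  shows "nz_col_est \<Omega> S i \<in> carrier_vec (length (col_support \<Omega> i))"
    and "l2_norm (nz_col_est \<Omega> S i - nz_col \<Omega> i) \<le> sqrt (length (col_support \<Omega> i)) * \<rho> / c"
proof -
  define s where "s = length (col_support \<Omega> i)"
  define P where "P = sel_mat \<Omega> i"
  define G where "G = transpose_mat P * S * P"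
  have P: "P \<in> carrier_mat p s" using sel_mat_carrier[of \<Omega> i] Om by (simp add: P_def s_def)
  have Pt: "transpose_mat P \<in> carrier_mat s p" using P by simp
  have G: "G \<in> carrier_mat s s" using P S by (simp add: G_def)
  have Gv: "G *\<^sub>v d = transpose_mat P *\<^sub>v (S *\<^sub>v (P *\<^sub>v d))" if "d \<in> carrier_vec s" for d
  proof -
    have "G *\<^sub>v d = (transpose_mat P * S) *\<^sub>v (P *\<^sub>v d)"
      unfolding G_def using P S that by (intro assoc_mult_mat_vec) auto
    also have "\<dots> = transpose_mat P *\<^sub>v (S *\<^sub>v (P *\<^sub>v d))"
      using P S that by (intro assoc_mult_mat_vec) auto
    finally show ?thesis .
  qed
  have form: "c * (d \<bullet> d) \<le> d \<bullet> (G *\<^sub>v d)" if d: "d \<in> carrier_vec s" for d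
  proof -
    have Pd: "P *\<^sub>v d \<in> carrier_vec p" using P d by auto
    have SPd: "S *\<^sub>v (P *\<^sub>v d) \<in> carrier_vec p" using S Pd by auto
    have "(P *\<^sub>v d) \<bullet> (P *\<^sub>v d) = d \<bullet> d"
      using sum_sel_mat_mult_vec[of d \<Omega> i "\<lambda>x. x * x"] d Om Pd carrier_matD(1)[OF P]
      by (simp add: scalar_prod_def atLeast0LessThan P_def s_def del: index_mult_mat_vec)
    moreover have "d \<bullet> (G *\<^sub>v d) = (P *\<^sub>v d) \<bullet> (S *\<^sub>v (P *\<^sub>v d))"
    proof -
      have "d \<bullet> (G *\<^sub>v d) = (transpose_mat P *\<^sub>v (S *\<^sub>v (P *\<^sub>v d))) \<bullet> d"
        unfolding Gv[OF d] using Pt SPd d by (intro comm_scalar_prod[of _ s]) auto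
      also have "\<dots> = (S *\<^sub>v (P *\<^sub>v d)) \<bullet> (P *\<^sub>v d)"
        using P d SPd by (rule transpose_vec_mult_scalar)
      also have "\<dots> = (P *\<^sub>v d) \<bullet> (S *\<^sub>v (P *\<^sub>v d))"
        using Pd SPd by (rule comm_scalar_prod[of _ p, rotated])
      finally show ?thesis .
    qed
    moreover have "c * ((P *\<^sub>v d) \<bullet> (P *\<^sub>v d)) \<le> (P *\<^sub>v d) \<bullet> (S *\<^sub>v (P *\<^sub>v d))"
    proof (rule low[OF Pd], intro allI impI)
      fix j assume "j < p" "\<Omega> $$ (j, i) = 0"
      then show "(P *\<^sub>v d) $ j = 0"
        unfolding P_def using d Om
        by (intro sel_mat_mult_vec_off_support) (auto simp: s_def col_support_props(2))
    qed
    ultimately show ?thesis by simp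
  qed
  have "d \<bullet> (G *\<^sub>v d) > 0" if "d \<in> carrier_vec s" "d \<noteq> 0\<^sub>v s" for d
  proof -
    have "d \<bullet> d > 0"
      using scalar_prod_self_nonneg[of d] scalar_prod_self_eq_0[of d s] that by force
    then have "0 < c * (d \<bullet> d)" using c by simp
    then show ?thesis using form[OF that(1)] by simp
  qed
  note Ginv = positive_form_mat_inv[OF G this]
  define f where "f = transpose_mat P *\<^sub>v unit_vec p i"
  have f: "f \<in> carrier_vec s" using Pt by (simp add: f_def)
  have est: "nz_col_est \<Omega> S i = mat_inv G *\<^sub>v f"
    using Om by (simp add: nz_col_est_def G_def P_def f_def)
  then have est_c: "nz_col_est \<Omega> S i \<in> carrier_vec s" using Ginv(1) f by auto
  then show "nz_col_est \<Omega> S i \<in> carrier_vec (length (col_support \<Omega> i))" by (simp add: s_def)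
  define w where "w = nz_col \<Omega> i"
  have w: "w \<in> carrier_vec s" using nz_col_carrier[of \<Omega> i] by (simp add: w_def s_def)
  have Pw: "P *\<^sub>v w = col \<Omega> i" using sel_mat_mult_nz_col[of i \<Omega>] i Om by (simp add: P_def w_def)
  have Gest: "G *\<^sub>v nz_col_est \<Omega> S i = f"
  proof -
    have "G *\<^sub>v nz_col_est \<Omega> S i = (G * mat_inv G) *\<^sub>v f"
      unfolding est using G Ginv(1) f by (intro assoc_mult_mat_vec[symmetric]) auto
    then show ?thesis using Ginv(2) f by simp
  qed
  define d where "d = nz_col_est \<Omega> S i - w"
  have d: "d \<in> carrier_vec s" using est_c w by (simp add: d_def)
  have Gd: "G *\<^sub>v d = f - G *\<^sub>v w"
    unfolding d_def Gest[symmetric] using G est_c w by (intro mult_minus_distrib_mat_vec) auto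
  have entry: "\<bar>(G *\<^sub>v d) $ k\<bar> \<le> \<rho>" if k: "k < s" for k
  proof -
    let ?j = "col_support \<Omega> i ! k"
    have j: "?j < p" using nth_mem[of k "col_support \<Omega> i"] k Om by (auto simp: s_def col_support_props(2))
    have Scol: "S *\<^sub>v col \<Omega> i \<in> carrier_vec p" using S Om by auto
    have "(G *\<^sub>v d) $ k = f $ k - (G *\<^sub>v w) $ k"
      unfolding Gd using k G w f by (intro index_minus_vec) auto
    also have "f $ k = unit_vec p i $ ?j"
      unfolding f_def P_def using k Om by (intro transpose_sel_mat_mult_vec) (auto simp: s_def)
    also have "(G *\<^sub>v w) $ k = (S *\<^sub>v col \<Omega> i) $ ?j"
      unfolding Gv[OF w] Pw unfolding P_def using k Om Scol
      by (intro transpose_sel_mat_mult_vec) (auto simp: s_def)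
    finally show ?thesis using res[OF j] by (simp add: abs_minus_commute)
  qed
  have dim: "dim_vec d = s" using d by simp
  have "c * (l2_norm d)\<^sup>2 = c * (d \<bullet> d)" by (simp add: l2_norm_def scalar_prod_self_nonneg)
  also have "\<dots> \<le> d \<bullet> (G *\<^sub>v d)" by (rule form[OF d])
  also have "\<dots> = (\<Sum>k<s. d $ k * (G *\<^sub>v d) $ k)"
    using G d by (simp add: scalar_prod_def atLeast0LessThan del: index_mult_mat_vec)
  also have "\<dots> \<le> (\<Sum>k<s. \<bar>d $ k\<bar> * \<rho>)"
  proof (intro sum_mono)
    fix k assume "k \<in> {..<s}"
    have "d $ k * (G *\<^sub>v d) $ k \<le> \<bar>d $ k\<bar> * \<bar>(G *\<^sub>v d) $ k\<bar>"
      by (metis abs_ge_self abs_mult)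
    also have "\<dots> \<le> \<bar>d $ k\<bar> * \<rho>" using entry \<open>k \<in> {..<s}\<close> by (intro mult_left_mono) auto
    finally show "d $ k * (G *\<^sub>v d) $ k \<le> \<bar>d $ k\<bar> * \<rho>" .
  qed
  also have "\<dots> \<le> (sqrt s * l2_norm d) * \<rho>"
    using sum_abs_le_l2_norm[of d] \<rho> dim
    by (simp add: sum_distrib_right[symmetric] mult_right_mono)
  finally have *: "l2_norm d * (c * l2_norm d) \<le> l2_norm d * (sqrt s * \<rho>)"
    by (simp add: power2_eq_square mult_ac)
  have "c * l2_norm d \<le> sqrt s * \<rho>"
  proof (cases "l2_norm d = 0")
    case False
    then have "l2_norm d > 0" by (simp add: l2_norm_eq less_le)
    then show ?thesis using * by (simp add: mult_le_cancel_left_pos)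
  qed (use \<rho> in auto)
  then show "l2_norm (nz_col_est \<Omega> S i - nz_col \<Omega> i) \<le> sqrt (length (col_support \<Omega> i)) * \<rho> / c"
    using c by (simp add: d_def w_def s_def field_simps)
qed

lemma max_col_error_le:
  assumes "0 < dim_col \<Omega>"
    and "\<And>i. i < dim_col \<Omega> \<Longrightarrow> l2_norm (nz_col_est \<Omega> S i - nz_col \<Omega> i) \<le> e"
  shows "\<bar>max_col_error \<Omega> S\<bar> \<le> e"
proof -
  have "l2_norm (nz_col_est \<Omega> S 0 - nz_col \<Omega> 0) \<le> max_col_error \<Omega> S"
    unfolding max_col_error_def using assms by (intro Max_ge) auto
  moreover have "0 \<le> l2_norm (nz_col_est \<Omega> S 0 - nz_col \<Omega> 0)" by (simp add: l2_norm_eq)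
  moreover have "max_col_error \<Omega> S \<le> e"
    unfolding max_col_error_def using assms by (intro Max.boundedI) auto
  ultimately show ?thesis by simp
qed

text \<open>A column of the error matrix is the zero-padded error of one block. The Cauchy-Schwarz
  inequality bounds its 1-norm by the Euclidean norm times the root of the block size.\<close>

lemma prec_est_error_le:
  fixes \<Omega> S :: "real mat"
  assumes Om: "\<Omega> \<in> carrier_mat p p" and p: "p > 0"
    and car: "\<And>i. i < p \<Longrightarrow> nz_col_est \<Omega> S i \<in> carrier_vec (length (col_support \<Omega> i))"
    and err: "\<And>i. i < p \<Longrightarrow>
      sqrt (length (col_support \<Omega> i)) * l2_norm (nz_col_est \<Omega> S i - nz_col \<Omega> i) \<le> e"
  shows "\<bar>mat_norm1 (prec_est \<Omega> S - \<Omega>)\<bar> \<le> e"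
proof -
  have dims: "dim_row (prec_est \<Omega> S - \<Omega>) = p" "dim_col (prec_est \<Omega> S - \<Omega>) = p"
    using Om by auto
  have col: "(\<Sum>r<p. \<bar>(prec_est \<Omega> S - \<Omega>) $$ (r, i)\<bar>) \<le> e" if i: "i < p" for i
  proof -
    define s where "s = length (col_support \<Omega> i)"
    define d where "d = nz_col_est \<Omega> S i - nz_col \<Omega> i"
    have d: "d \<in> carrier_vec s" using car[OF i] nz_col_carrier[of \<Omega> i] by (simp add: d_def s_def)
    have P: "sel_mat \<Omega> i \<in> carrier_mat p s" using sel_mat_carrier[of \<Omega> i] Om by (simp add: s_def)
    have "(prec_est \<Omega> S - \<Omega>) $$ (r, i) = (sel_mat \<Omega> i *\<^sub>v d) $ r" if r: "r < p" for r
    proof -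
      have "sel_mat \<Omega> i *\<^sub>v d = sel_mat \<Omega> i *\<^sub>v nz_col_est \<Omega> S i - sel_mat \<Omega> i *\<^sub>v nz_col \<Omega> i"
        unfolding d_def using P car[OF i] nz_col_carrier[of \<Omega> i]
        by (intro mult_minus_distrib_mat_vec) (auto simp: s_def)
      moreover have "sel_mat \<Omega> i *\<^sub>v nz_col \<Omega> i = col \<Omega> i"
        using sel_mat_mult_nz_col[of i \<Omega>] Om i by simp
      ultimately have "(sel_mat \<Omega> i *\<^sub>v d) $ r = (sel_mat \<Omega> i *\<^sub>v nz_col_est \<Omega> S i) $ r - col \<Omega> i $ r"
        using r Om by (simp del: index_mult_mat_vec)
      then show ?thesis
        using r i Om by (simp add: prec_est_def mat_of_cols_index del: index_mult_mat_vec)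
    qed
    then have "(\<Sum>r<p. \<bar>(prec_est \<Omega> S - \<Omega>) $$ (r, i)\<bar>) = (\<Sum>r<p. \<bar>(sel_mat \<Omega> i *\<^sub>v d) $ r\<bar>)"
      by (intro sum.cong) auto
    also have "\<dots> = (\<Sum>k<s. \<bar>d $ k\<bar>)"
      using sum_sel_mat_mult_vec[of d \<Omega> i abs] d Om by (simp add: s_def)
    also have "\<dots> \<le> sqrt s * l2_norm d" using sum_abs_le_l2_norm[of d] d by simp
    also have "\<dots> \<le> e" using err[OF i] by (simp add: s_def d_def)
    finally show ?thesis .
  qed
  have "0 \<le> (\<Sum>r<p. \<bar>(prec_est \<Omega> S - \<Omega>) $$ (r, 0)\<bar>)" by (intro sum_nonneg) auto
  also have "\<dots> \<le> mat_norm1 (prec_est \<Omega> S - \<Omega>)"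
    unfolding mat_norm1_def dims using p by (intro Max_ge) auto
  finally have "0 \<le> mat_norm1 (prec_est \<Omega> S - \<Omega>)" .
  moreover have "mat_norm1 (prec_est \<Omega> S - \<Omega>) \<le> e"
    unfolding mat_norm1_def dims using p col by (intro Max.boundedI) auto
  ultimately show ?thesis by simp
qed

section \<open>The sample covariance matrix as a quadratic form\<close>

lemma sample_cov_carrier: "sample_cov p n x \<in> carrier_mat p p"
  by (simp add: sample_cov_def)

lemma sample_cov_form:
  assumes x: "\<And>k. k < n \<Longrightarrow> x k \<in> carrier_vec p"
    and a: "a \<in> carrier_vec p" and b: "b \<in> carrier_vec p"
  shows "a \<bullet> (sample_cov p n x *\<^sub>v b) =
    (\<Sum>k<n. (a \<bullet> x k - (\<Sum>l<n. a \<bullet> x l) / real n) * (b \<bullet> x k - (\<Sum>l<n. b \<bullet> x l) / real n)) / (real n - 1)"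
proof -
  define c where "c k j = x k $ j - sample_mean p n x $ j" for k j
  have centre: "u \<bullet> x k - (\<Sum>l<n. u \<bullet> x l) / real n = (\<Sum>j<p. u $ j * c k j)"
    if u: "u \<in> carrier_vec p" and k: "k < n" for u k
  proof -
    have dot: "u \<bullet> x l = (\<Sum>j<p. u $ j * x l $ j)" if "l < n" for l
      using x[OF that] by (simp add: scalar_prod_def atLeast0LessThan)
    have "(\<Sum>l<n. u \<bullet> x l) / real n = (\<Sum>l<n. \<Sum>j<p. u $ j * x l $ j) / real n"
      using dot by simp
    also have "\<dots> = (\<Sum>j<p. u $ j * sample_mean p n x $ j)"
      by (subst sum.swap) (simp add: sample_mean_def sum_distrib_left sum_divide_distrib)
    finally show ?thesis
      using dot[OF k] by (simp add: c_def sum_subtractf right_diff_distrib)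
  qed
  have "a \<bullet> (sample_cov p n x *\<^sub>v b)
      = (\<Sum>i<p. \<Sum>j<p. (\<Sum>k<n. c k i * c k j) / (real n - 1) * a $ i * b $ j)"
    unfolding quadratic_form_eq_sum[OF sample_cov_carrier a b]
    by (intro sum.cong) (auto simp: sample_cov_def c_def)
  also have "\<dots> = (\<Sum>i<p. \<Sum>j<p. \<Sum>k<n. (a $ i * c k i) * (b $ j * c k j)) / (real n - 1)"
    by (simp add: sum_divide_distrib sum_distrib_left sum_distrib_right mult_ac)
  also have "(\<Sum>i<p. \<Sum>j<p. \<Sum>k<n. (a $ i * c k i) * (b $ j * c k j))
      = (\<Sum>i<p. \<Sum>k<n. \<Sum>j<p. (a $ i * c k i) * (b $ j * c k j))"
    by (intro sum.cong sum.swap) auto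
  also have "\<dots> = (\<Sum>k<n. \<Sum>i<p. \<Sum>j<p. (a $ i * c k i) * (b $ j * c k j))"
    by (rule sum.swap)
  also have "\<dots> = (\<Sum>k<n. (\<Sum>i<p. a $ i * c k i) * (\<Sum>j<p. b $ j * c k j))"
    by (simp add: sum_product)
  finally show ?thesis using centre[OF a] centre[OF b] by simp
qed

text \<open>The value of the form at \<open>a\<close> is the sample variance of the projected sample \<open>a \<bullet> x k\<close>, which
  reduces all multivariate questions to univariate ones.\<close>

lemma sample_cov_quadratic_form:
  assumes "\<And>k. k < n \<Longrightarrow> x k \<in> carrier_vec p" "a \<in> carrier_vec p"
  shows "a \<bullet> (sample_cov p n x *\<^sub>v a) = centered_ss n (\<lambda>k. a \<bullet> x k) / (real n - 1)"
  unfolding centered_ss_def using sample_cov_form[OF assms(1) assms(2,2)]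
  by (simp add: power2_eq_square)

lemma L2_set_scale: "L2_set (\<lambda>k. r * f k) K = \<bar>r\<bar> * L2_set f K"
  by (simp add: L2_set_def power_mult_distrib sum_distrib_left[symmetric] real_sqrt_mult)

lemma L2_set_linear_combination_le:
  assumes "finite J"
  shows "L2_set (\<lambda>k. \<Sum>j\<in>J. u j * c k j) K \<le> (\<Sum>j\<in>J. \<bar>u j\<bar> * L2_set (\<lambda>k. c k j) K)"
  using assms
proof (induction J)
  case empty
  then show ?case by (simp add: L2_set_0')
next
  case (insert j J)
  have "L2_set (\<lambda>k. u j * c k j + (\<Sum>j\<in>J. u j * c k j)) K
      \<le> L2_set (\<lambda>k. u j * c k j) K + L2_set (\<lambda>k. \<Sum>j\<in>J. u j * c k j) K"
    by (rule L2_set_triangle_ineq)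
  then show ?case using insert by (simp add: L2_set_scale)
qed

text \<open>The right-hand side is a seminorm \<open>q\<close> of \<open>v\<close>. Scale \<open>v\<close> to Euclidean norm \<open>N\<close> and round its
  coordinates to integers \<open>g\<close>. The rounding error has coordinates of modulus at most 1, hence
  \<open>q\<close>-value at most \<open>b * card J\<close> and Euclidean norm at most \<open>card J\<close>, so
  \<open>q (scaled v) \<ge> a (N - card J) - b card J\<close>, and the two conditions on \<open>N\<close> leave a quarter of \<open>a N\<close>.\<close>

lemma integer_net_lower_bound:
  fixes c :: "'k \<Rightarrow> 'j \<Rightarrow> real" and N :: nat
  assumes J: "finite J" and K: "finite K" and N: "N > 0" and a: "a \<ge> 0"
    and cols: "\<And>j. j \<in> J \<Longrightarrow> L2_set (\<lambda>k. c k j) K \<le> b"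
    and net: "\<And>g. g \<in> J \<rightarrow>\<^sub>E {- int N..int N} \<Longrightarrow>
      a * L2_set (\<lambda>j. real_of_int (g j)) J \<le> L2_set (\<lambda>k. \<Sum>j\<in>J. real_of_int (g j) * c k j) K"
    and N1: "2 * card J \<le> N" and N2: "4 * b * card J \<le> a * N"
  shows "a / 4 * L2_set v J \<le> L2_set (\<lambda>k. \<Sum>j\<in>J. v j * c k j) K"
proof (cases "L2_set v J = 0")
  case False
  define q where "q u = L2_set (\<lambda>k. \<Sum>j\<in>J. u j * c k j) K" for u :: "'j \<Rightarrow> real"
  define r where "r = L2_set v J"
  have r: "r > 0" using False by (simp add: r_def less_le)
  define w where "w j = real N / r * v j" for j
  define g where "g = restrict (\<lambda>j. \<lfloor>w j\<rfloor>) J"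
  define z where "z j = real_of_int (g j) - w j" for j
  have z: "\<bar>z j\<bar> \<le> 1" if "j \<in> J" for j
    using that by (simp add: z_def g_def) linarith
  have w: "\<bar>w j\<bar> \<le> N" if "j \<in> J" for j
  proof -
    have "\<bar>v j\<bar> \<le> r" unfolding r_def using J that
      by (metis L2_set_def abs_le_square_iff member_le_sum real_le_rsqrt zero_le_power2 power2_abs)
    then have "real N * \<bar>v j\<bar> \<le> real N * r" by (intro mult_left_mono) auto
    then show ?thesis using r by (simp add: w_def abs_mult field_simps)
  qed
  have g: "g \<in> J \<rightarrow>\<^sub>E {- int N..int N}"
  proof -
    have "- int N \<le> \<lfloor>w j\<rfloor> \<and> \<lfloor>w j\<rfloor> \<le> int N" if "j \<in> J" for j
      using w[OF that] by (simp add: le_floor_iff floor_le_iff abs_le_iff)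
    then show ?thesis by (auto simp: g_def)
  qed
  have sz: "(\<Sum>j\<in>J. \<bar>z j\<bar>) \<le> card J"
    using sum_bounded_above[of J "\<lambda>j. \<bar>z j\<bar>" 1] z by simp
  have wL: "L2_set w J = N"
    using r unfolding w_def L2_set_scale by (simp add: r_def)
  have "L2_set w J = L2_set (\<lambda>j. real_of_int (g j) + (- 1) * z j) J"
    by (simp add: z_def)
  also have "\<dots> \<le> L2_set (\<lambda>j. real_of_int (g j)) J + L2_set (\<lambda>j. (- 1) * z j) J"
    by (rule L2_set_triangle_ineq)
  also have "L2_set (\<lambda>j. (- 1) * z j) J \<le> card J"
    unfolding L2_set_scale using L2_set_le_sum_abs[of z J] sz by simp
  finally have gL: "N - real (card J) \<le> L2_set (\<lambda>j. real_of_int (g j)) J"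
    using wL by simp
  have qz: "q z \<le> card J * b"
  proof -
    have "q z \<le> (\<Sum>j\<in>J. \<bar>z j\<bar> * L2_set (\<lambda>k. c k j) K)"
      unfolding q_def by (rule L2_set_linear_combination_le[OF J])
    also have "\<dots> \<le> (\<Sum>j\<in>J. 1 * b)"
      using z cols by (intro sum_mono mult_mono) auto
    finally show ?thesis by simp
  qed
  have "q (\<lambda>j. real_of_int (g j)) = L2_set (\<lambda>k. (\<Sum>j\<in>J. w j * c k j) + (\<Sum>j\<in>J. z j * c k j)) K"
    by (simp add: q_def z_def sum.distrib[symmetric] algebra_simps)
  also have "\<dots> \<le> q w + q z" unfolding q_def by (rule L2_set_triangle_ineq)
  also have "q w = N / r * q v"
  proof -
    have "q w = L2_set (\<lambda>k. N / r * (\<Sum>j\<in>J. v j * c k j)) K"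
      unfolding q_def by (intro L2_set_cong) (auto simp: w_def sum_distrib_left mult_ac)
    then show ?thesis using r unfolding L2_set_scale q_def by simp
  qed
  finally have qg: "q (\<lambda>j. real_of_int (g j)) \<le> N / r * q v + card J * b" using qz by simp
  define T where "T = N / r * q v"
  have "q (\<lambda>j. real_of_int (g j)) \<le> T + card J * b" using qg by (simp add: T_def)
  moreover have "a * (N - real (card J)) \<le> q (\<lambda>j. real_of_int (g j))"
    using net[OF g] mult_left_mono[OF gL a] by (simp add: q_def)
  moreover have "a * (2 * card J) \<le> a * N"
    using N1 a by (intro mult_left_mono) linarith+
  ultimately have "a * N / 4 \<le> T" using N2 by (simp add: algebra_simps)
  then have "N * (a / 4 * r) \<le> N * q v" using r by (simp add: T_def field_simps)
  then show ?thesis using N by (simp add: q_def r_def)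
qed (use a in simp)

definition grid_vec :: "nat \<Rightarrow> nat set \<Rightarrow> (nat \<Rightarrow> int) \<Rightarrow> real vec" where
  "grid_vec p J g = vec p (\<lambda>j. if j \<in> J then real_of_int (g j) else 0)"

text \<open>Lemma \<open>integer_net_lower_bound\<close> for the seminorm \<open>v \<mapsto> sqrt (v \<bullet> S v)\<close>, which is the Euclidean norm of the
  projected, centred and normalised sample. The bound \<open>b\<close> for the coordinate directions
  involves only the diagonal of the sample covariance matrix.\<close>

lemma sample_cov_lower_bound:
  assumes x: "\<And>k. k < n \<Longrightarrow> x k \<in> carrier_vec p" and n: "n \<ge> 2"
    and J: "J \<subseteq> {..<p}" and N: "N > 0" and a: "a \<ge> 0" and b: "b \<ge> 0"
    and diag: "\<And>j. j \<in> J \<Longrightarrow> unit_vec p j \<bullet> (sample_cov p n x *\<^sub>v unit_vec p j) \<le> b\<^sup>2"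
    and net: "\<And>g. g \<in> J \<rightarrow>\<^sub>E {- int N..int N} \<Longrightarrow> 
      a\<^sup>2 * (grid_vec p J g \<bullet> grid_vec p J g)
        \<le> grid_vec p J g \<bullet> (sample_cov p n x *\<^sub>v grid_vec p J g)"
    and N1: "2 * card J \<le> N" and N2: "4 * b * card J \<le> a * N"
    and v: "v \<in> carrier_vec p" and supp: "\<And>j. j < p \<Longrightarrow> j \<notin> J \<Longrightarrow> v $ j = 0"
  shows "(a / 4)\<^sup>2 * (v \<bullet> v) \<le> v \<bullet> (sample_cov p n x *\<^sub>v v)"
proof -
  have fin: "finite J" using J finite_subset by blast
  have n1: "real n - 1 > 0" using n by simp
  define m where "m = sqrt (real n - 1)"
  have m: "m > 0" "m\<^sup>2 = real n - 1" using n1 by (auto simp: m_def)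
  define e where "e j = (\<Sum>l<n. x l $ j) / real n" for j
  define c where "c k j = (x k $ j - e j) / m" for k j
  have form: "u \<bullet> (sample_cov p n x *\<^sub>v u) = (L2_set (\<lambda>k. \<Sum>j\<in>J. u $ j * c k j) {..<n})\<^sup>2"
    if u: "u \<in> carrier_vec p" and u0: "\<And>j. j < p \<Longrightarrow> j \<notin> J \<Longrightarrow> u $ j = 0" for u
  proof -
    have dot: "u \<bullet> x l = (\<Sum>j\<in>J. u $ j * x l $ j)" if "l < n" for l
    proof -
      have "u \<bullet> x l = (\<Sum>j<p. u $ j * x l $ j)"
        using x[OF that] by (simp add: scalar_prod_def atLeast0LessThan)
      also have "\<dots> = (\<Sum>j\<in>J. u $ j * x l $ j)"
        using J u0 by (intro sum.mono_neutral_right) auto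
      finally show ?thesis .
    qed
    have "(\<Sum>l<n. u \<bullet> x l) / real n = (\<Sum>j\<in>J. u $ j * e j)"
      using dot by (simp add: e_def sum.swap[of _ J] sum_distrib_left sum_divide_distrib)
    then have "(u \<bullet> x k - (\<Sum>l<n. u \<bullet> x l) / real n) / m = (\<Sum>j\<in>J. u $ j * c k j)" if "k < n" for k
      using dot[OF that]
      by (simp add: c_def sum_subtractf[symmetric] sum_divide_distrib right_diff_distrib diff_divide_distrib)
    then have "(L2_set (\<lambda>k. \<Sum>j\<in>J. u $ j * c k j) {..<n})\<^sup>2
        = (\<Sum>k<n. ((u \<bullet> x k - (\<Sum>l<n. u \<bullet> x l) / real n) / m)\<^sup>2)"
      by (simp add: L2_set_def sum_nonneg)
    also have "\<dots> = centered_ss n (\<lambda>k. u \<bullet> x k) / (real n - 1)"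
      by (simp add: power_divide m centered_ss_def sum_divide_distrib)
    finally show ?thesis using sample_cov_quadratic_form[OF x u] by simp
  qed
  have self: "u \<bullet> u = (L2_set (\<lambda>j. u $ j) J)\<^sup>2"
    if u: "u \<in> carrier_vec p" and u0: "\<And>j. j < p \<Longrightarrow> j \<notin> J \<Longrightarrow> u $ j = 0" for u :: "real vec"
  proof -
    have "u \<bullet> u = (\<Sum>j<p. (u $ j)\<^sup>2)"
      using u by (simp add: scalar_prod_def atLeast0LessThan power2_eq_square)
    also have "\<dots> = (\<Sum>j\<in>J. (u $ j)\<^sup>2)"
      using J u0 by (intro sum.mono_neutral_right) auto
    finally show ?thesis by (simp add: L2_set_def sum_nonneg)
  qed
  have "a / 4 * L2_set (\<lambda>j. v $ j) J \<le> L2_set (\<lambda>k. \<Sum>j\<in>J. v $ j * c k j) {..<n}"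
  proof (rule integer_net_lower_bound[OF fin _ N a _ _ N1 N2])
    fix j assume j: "j \<in> J"
    have jp: "j < p" using j J by auto
    have "unit_vec p j $ i = (0 :: real)" if "i < p" "i \<notin> J" for i
      using that j jp by auto
    then have "(L2_set (\<lambda>k. \<Sum>i\<in>J. unit_vec p j $ i * c k i) {..<n})\<^sup>2 \<le> b\<^sup>2"
      using diag[OF j] form[OF unit_vec_carrier] by simp
    moreover have "(\<Sum>i\<in>J. unit_vec p j $ i * c k i) = c k j" for k
    proof -
      have "(\<Sum>i\<in>J. unit_vec p j $ i * c k i) = (\<Sum>i\<in>J. if i = j then c k i else 0)"
        using J jp by (intro sum.cong) auto
      then show ?thesis using fin j by simp
    qed
    ultimately have "(L2_set (\<lambda>k. c k j) {..<n})\<^sup>2 \<le> b\<^sup>2" by simp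
    then show "L2_set (\<lambda>k. c k j) {..<n} \<le> b" using b by (rule power2_le_imp_le)
  next
    fix g assume g: "g \<in> J \<rightarrow>\<^sub>E {- int N..int N}"
    let ?u = "grid_vec p J g"
    have u: "?u \<in> carrier_vec p" "\<And>j. j < p \<Longrightarrow> j \<notin> J \<Longrightarrow> ?u $ j = 0"
      "\<And>j. j \<in> J \<Longrightarrow> ?u $ j = real_of_int (g j)"
      using J by (auto simp: grid_vec_def)
    have "(a * L2_set (\<lambda>j. ?u $ j) J)\<^sup>2 \<le> (L2_set (\<lambda>k. \<Sum>j\<in>J. ?u $ j * c k j) {..<n})\<^sup>2"
      using net[OF g] form[OF u(1,2)] self[OF u(1,2)] by (simp add: power_mult_distrib)
    then have "a * L2_set (\<lambda>j. ?u $ j) J \<le> L2_set (\<lambda>k. \<Sum>j\<in>J. ?u $ j * c k j) {..<n}"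
      by (rule power2_le_imp_le) simp
    moreover have "L2_set (\<lambda>j. ?u $ j) J = L2_set (\<lambda>j. real_of_int (g j)) J"
      using u(3) by (intro L2_set_cong) auto
    moreover have "(\<lambda>k. \<Sum>j\<in>J. ?u $ j * c k j) = (\<lambda>k. \<Sum>j\<in>J. real_of_int (g j) * c k j)"
      using u(3) by (intro ext sum.cong) auto
    ultimately show "a * L2_set (\<lambda>j. real_of_int (g j)) J
        \<le> L2_set (\<lambda>k. \<Sum>j\<in>J. real_of_int (g j) * c k j) {..<n}" by simp
  qed simp
  then have "(a / 4 * L2_set (\<lambda>j. v $ j) J)\<^sup>2 \<le> (L2_set (\<lambda>k. \<Sum>j\<in>J. v $ j * c k j) {..<n})\<^sup>2"
    using a by (intro power_mono) auto
  moreover have "v \<bullet> (sample_cov p n x *\<^sub>v v) = (L2_set (\<lambda>k. \<Sum>j\<in>J. v $ j * c k j) {..<n})\<^sup>2"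
    using v supp by (rule form)
  moreover have "v \<bullet> v = (L2_set (\<lambda>j. v $ j) J)\<^sup>2"
    using v supp by (rule self)
  ultimately show ?thesis by (simp only: power_mult_distrib)
qed

section \<open>Quadratic forms of the sample covariance matrix of a normal sample\<close>

text \<open>Every projection of the sample is a univariate normal sample, so the quadratic form at \<open>a\<close> is
  its expectation \<open>a \<bullet> \<Sigma> a\<close> times the sample variance of a standard normal sample.\<close>

lemma (in prob_space) standardised_linear_combination:
  assumes iid: "iid_multivariate_normal M n p X \<mu> \<Sigma>" and Sig: "pos_def_mat p \<Sigma>"
    and a: "a \<in> carrier_vec p" "a \<noteq> 0\<^sub>v p" and n: "n > 0"
  obtains Z where "indep_vars (\<lambda>_. borel) Z {..<n}"
    and "\<And>k. k < n \<Longrightarrow> distributed M lborel (Z k) std_normal_density"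
    and "\<And>\<omega>. \<omega> \<in> space M \<Longrightarrow> a \<bullet> (sample_cov p n (\<lambda>k. X k \<omega>) *\<^sub>v a)
      = a \<bullet> (\<Sigma> *\<^sub>v a) * (centered_ss n (\<lambda>k. Z k \<omega>) / (real n - 1))"
proof
  define \<sigma> where "\<sigma> = sqrt (a \<bullet> (\<Sigma> *\<^sub>v a))"
  have v: "a \<bullet> (\<Sigma> *\<^sub>v a) > 0" using Sig a by (auto simp: pos_def_mat_def)
  have \<sigma>: "\<sigma> > 0" "\<sigma>\<^sup>2 = a \<bullet> (\<Sigma> *\<^sub>v a)" using v by (auto simp: \<sigma>_def)
  have car: "X k \<omega> \<in> carrier_vec p" if "k < n" "\<omega> \<in> space M" for k \<omega>
    using iid that by (auto simp: iid_multivariate_normal_def multivariate_normal_def)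
  \<comment> \<open>A coordinate sum instead of a scalar product: outside the sample space the vectors may have another dimension.\<close>
  define Z where "Z k \<omega> = ((\<Sum>j<p. a $ j * X k \<omega> $ j) - a \<bullet> \<mu>) / \<sigma>" for k \<omega>
  have Zeq: "Z k \<omega> = (a \<bullet> X k \<omega> - a \<bullet> \<mu>) / \<sigma>" if "k < n" "\<omega> \<in> space M" for k \<omega>
    using car[OF that] by (simp add: Z_def scalar_prod_def atLeast0LessThan)
  have "indep_vars (\<lambda>_. \<Pi>\<^sub>M j\<in>{..<p}. borel) (\<lambda>k \<omega>. \<lambda>j\<in>{..<p}. X k \<omega> $ j) {..<n}"
    using iid by (simp add: iid_multivariate_normal_def)
  then have "indep_vars (\<lambda>_. borel) (\<lambda>k \<omega>. (\<lambda>x. ((\<Sum>j<p. a $ j * x j) - a \<bullet> \<mu>) / \<sigma>)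
      (\<lambda>j\<in>{..<p}. X k \<omega> $ j)) {..<n}"
    by (rule indep_vars_compose2) measurable
  then show "indep_vars (\<lambda>_. borel) Z {..<n}"
    by (simp add: Z_def[abs_def])
  show "distributed M lborel (Z k) std_normal_density" if k: "k < n" for k
  proof -
    have "distributed M lborel (\<lambda>\<omega>. a \<bullet> X k \<omega>) (normal_density (a \<bullet> \<mu>) \<sigma>)"
      using iid a k unfolding \<sigma>_def by (auto simp: iid_multivariate_normal_def multivariate_normal_def)
    then have D: "distributed M lborel (\<lambda>\<omega>. (a \<bullet> X k \<omega> - a \<bullet> \<mu>) / \<sigma>) std_normal_density"
      using normal_standard_normal_convert[OF \<sigma>(1)] by simp
    then show ?thesis
      using measurable_cong[of M "Z k" "\<lambda>\<omega>. (a \<bullet> X k \<omega> - a \<bullet> \<mu>) / \<sigma>" lborel] Zeq[OF k]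
        distr_cong[of M M lborel lborel "Z k" "\<lambda>\<omega>. (a \<bullet> X k \<omega> - a \<bullet> \<mu>) / \<sigma>"]
      by (simp add: distributed_def)
  qed
  show "a \<bullet> (sample_cov p n (\<lambda>k. X k \<omega>) *\<^sub>v a)
      = a \<bullet> (\<Sigma> *\<^sub>v a) * (centered_ss n (\<lambda>k. Z k \<omega>) / (real n - 1))" if w: "\<omega> \<in> space M" for \<omega>
  proof -
    have "centered_ss n (\<lambda>k. Z k \<omega>) = centered_ss n (\<lambda>k. (a \<bullet> X k \<omega> - a \<bullet> \<mu>) / \<sigma>)"
      unfolding centered_ss_def using Zeq[OF _ w] by (intro sum.cong) auto
    also have "\<dots> = centered_ss n (\<lambda>k. a \<bullet> X k \<omega>) / \<sigma>\<^sup>2" by (rule centered_ss_affine[OF n])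
    finally show ?thesis
      using \<sigma>(1) car[OF _ w] a unfolding \<sigma>(2)[symmetric] by (simp add: sample_cov_quadratic_form)
  qed
qed

lemma centered_ss_measurable:
  assumes "\<And>k. k < n \<Longrightarrow> Z k \<in> borel_measurable M"
  shows "(\<lambda>\<omega>. centered_ss n (\<lambda>k. Z k \<omega>)) \<in> borel_measurable M"
  unfolding centered_ss_def
  by (intro borel_measurable_sum borel_measurable_power borel_measurable_diff
      borel_measurable_divide borel_measurable_const) (use assms in auto)

text \<open>The zero vector, which has no normal projection, is included: \<open>e - w\<close> vanishes if a column \<open>w\<close>
  of \<open>\<Omega>\<close> is a unit vector.\<close>

lemma (in prob_space) sample_cov_deviation:
  fixes L A :: real
  assumes iid: "iid_multivariate_normal M n p X \<mu> \<Sigma>" and Sig: "pos_def_mat p \<Sigma>"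
    and a: "a \<in> carrier_vec p" and n: "n \<ge> 2" and L: "1 \<le> L" "L \<le> A * n"
  shows "\<exists>E \<in> events. prob E \<le> 4 * exp (- 4 * L) \<and> (\<forall>\<omega> \<in> space M - E.
    \<bar>a \<bullet> (sample_cov p n (\<lambda>k. X k \<omega>) *\<^sub>v a) - a \<bullet> (\<Sigma> *\<^sub>v a)\<bar>
      \<le> dev_const A * sqrt (L / n) * (a \<bullet> (\<Sigma> *\<^sub>v a)))"
proof (cases "a = 0\<^sub>v p")
  case True
  have zero: "0\<^sub>v p \<bullet> (B *\<^sub>v 0\<^sub>v p) = (0::real)" if "B \<in> carrier_mat p p" for B
    using that by simp
  show ?thesis
    using True Sig zero[OF sample_cov_carrier] by (intro bexI[of _ "{}"]) (auto simp: pos_def_mat_def)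
next
  case False
  have v: "a \<bullet> (\<Sigma> *\<^sub>v a) > 0" using Sig a False by (auto simp: pos_def_mat_def)
  obtain Z where ind: "indep_vars (\<lambda>_. borel) Z {..<n}"
    and Z: "\<And>k. k < n \<Longrightarrow> distributed M lborel (Z k) std_normal_density"
    and S: "\<And>\<omega>. \<omega> \<in> space M \<Longrightarrow> a \<bullet> (sample_cov p n (\<lambda>k. X k \<omega>) *\<^sub>v a)
      = a \<bullet> (\<Sigma> *\<^sub>v a) * (centered_ss n (\<lambda>k. Z k \<omega>) / (real n - 1))"
    using standardised_linear_combination[OF iid Sig a False] n by auto
  have [measurable]: "(\<lambda>\<omega>. centered_ss n (\<lambda>k. Z k \<omega>)) \<in> borel_measurable M"
    by (rule centered_ss_measurable) (use Z in \<open>auto simp: distributed_def\<close>)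
  let ?E = "{\<omega> \<in> space M. \<bar>centered_ss n (\<lambda>k. Z k \<omega>) / (real n - 1) - 1\<bar> > dev_const A * sqrt (L / n)}"
  show ?thesis
  proof (intro bexI[of _ ?E] conjI ballI)
    show "prob ?E \<le> 4 * exp (- 4 * L)"
      by (rule std_normal_centered_ss_deviation[OF n ind Z L])
    fix \<omega> assume w: "\<omega> \<in> space M - ?E"
    define q where "q = centered_ss n (\<lambda>k. Z k \<omega>) / (real n - 1)"
    have q: "\<bar>q - 1\<bar> \<le> dev_const A * sqrt (L / n)" using w by (auto simp: q_def not_less)
    have "a \<bullet> (sample_cov p n (\<lambda>k. X k \<omega>) *\<^sub>v a) - a \<bullet> (\<Sigma> *\<^sub>v a) = (q - 1) * (a \<bullet> (\<Sigma> *\<^sub>v a))"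
      using S[of \<omega>] w by (simp add: q_def algebra_simps)
    then show "\<bar>a \<bullet> (sample_cov p n (\<lambda>k. X k \<omega>) *\<^sub>v a) - a \<bullet> (\<Sigma> *\<^sub>v a)\<bar>
        \<le> dev_const A * sqrt (L / n) * (a \<bullet> (\<Sigma> *\<^sub>v a))"
      using q v by (simp add: abs_mult mult_right_mono)
  qed measurable
qed

text \<open>The divisor is \<open>n - 1\<close> while there are \<open>n div 2\<close> pairs; the factor \<open>1/2\<close> accounts for the ratio,
  since \<open>n - 1 \<le> 2 (n div 2)\<close>.\<close>

lemma (in prob_space) sample_cov_small_ball:
  fixes B :: real
  assumes iid: "iid_multivariate_normal M n p X \<mu> \<Sigma>" and Sig: "pos_def_mat p \<Sigma>"
    and a: "a \<in> carrier_vec p" and n: "n \<ge> 2"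
  shows "\<exists>E \<in> events. prob E \<le> exp (- B * (n div 2)) \<and> (\<forall>\<omega> \<in> space M - E.
    small_ball_const B / 2 * (a \<bullet> (\<Sigma> *\<^sub>v a)) \<le> a \<bullet> (sample_cov p n (\<lambda>k. X k \<omega>) *\<^sub>v a))"
proof (cases "a = 0\<^sub>v p")
  case True
  have zero: "0\<^sub>v p \<bullet> (B *\<^sub>v 0\<^sub>v p) = (0::real)" if "B \<in> carrier_mat p p" for B
    using that by simp
  show ?thesis
    using True Sig zero[OF sample_cov_carrier] by (intro bexI[of _ "{}"]) (auto simp: pos_def_mat_def)
next
  case False
  have v: "a \<bullet> (\<Sigma> *\<^sub>v a) > 0" using Sig a False by (auto simp: pos_def_mat_def)
  obtain Z where ind: "indep_vars (\<lambda>_. borel) Z {..<n}"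
    and Z: "\<And>k. k < n \<Longrightarrow> distributed M lborel (Z k) std_normal_density"
    and S: "\<And>\<omega>. \<omega> \<in> space M \<Longrightarrow> a \<bullet> (sample_cov p n (\<lambda>k. X k \<omega>) *\<^sub>v a)
      = a \<bullet> (\<Sigma> *\<^sub>v a) * (centered_ss n (\<lambda>k. Z k \<omega>) / (real n - 1))"
    using standardised_linear_combination[OF iid Sig a False] n by auto
  have [measurable]: "(\<lambda>\<omega>. centered_ss n (\<lambda>k. Z k \<omega>)) \<in> borel_measurable M"
    by (rule centered_ss_measurable) (use Z in \<open>auto simp: distributed_def\<close>)
  let ?E = "{\<omega> \<in> space M. centered_ss n (\<lambda>k. Z k \<omega>) \<le> small_ball_const B * (n div 2)}"
  show ?thesis
  proof (intro bexI[of _ ?E] conjI ballI)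
    show "prob ?E \<le> exp (- B * (n div 2))"
      by (rule std_normal_centered_ss_small_ball[OF n ind Z])
    fix \<omega> assume w: "\<omega> \<in> space M - ?E"
    define Q where "Q = centered_ss n (\<lambda>k. Z k \<omega>)"
    have "real n - 1 \<le> 2 * real (n div 2)" by linarith
    then have "small_ball_const B * ((real n - 1) / 2) \<le> small_ball_const B * (n div 2)"
      by (intro mult_left_mono) (auto simp: small_ball_const_def)
    also have "\<dots> \<le> Q" using w by (auto simp: Q_def)
    finally have "small_ball_const B / 2 \<le> Q / (real n - 1)"
      using n by (simp add: field_simps)
    then have "small_ball_const B / 2 * (a \<bullet> (\<Sigma> *\<^sub>v a)) \<le> Q / (real n - 1) * (a \<bullet> (\<Sigma> *\<^sub>v a))"
      using v by (intro mult_right_mono) auto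
    then show "small_ball_const B / 2 * (a \<bullet> (\<Sigma> *\<^sub>v a)) \<le> a \<bullet> (sample_cov p n (\<lambda>k. X k \<omega>) *\<^sub>v a)"
      using S[of \<omega>] w by (simp add: Q_def mult.commute)
  qed measurable
qed

lemma (in prob_space) finite_union_of_exceptional_events:
  fixes e :: real
  assumes V: "finite V"
    and ex: "\<And>a. a \<in> V \<Longrightarrow> \<exists>E \<in> events. prob E \<le> e \<and> (\<forall>\<omega> \<in> space M - E. Q a \<omega>)"
  shows "\<exists>E \<in> events. prob E \<le> card V * e \<and> (\<forall>\<omega> \<in> space M - E. \<forall>a \<in> V. Q a \<omega>)"
proof -
  obtain E where E: "\<And>a. a \<in> V \<Longrightarrow> E a \<in> events" "\<And>a. a \<in> V \<Longrightarrow> prob (E a) \<le> e"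
    "\<And>a \<omega>. a \<in> V \<Longrightarrow> \<omega> \<in> space M - E a \<Longrightarrow> Q a \<omega>"
    using ex by metis
  have "prob (\<Union>a\<in>V. E a) \<le> (\<Sum>a\<in>V. prob (E a))"
    by (rule finite_measure_subadditive_finite[OF V]) (use E in auto)
  also have "\<dots> \<le> card V * e" using E(2) by (rule sum_bounded_above)
  finally show ?thesis using E V by (intro bexI[of _ "\<Union>a\<in>V. E a"]) auto
qed

section \<open>Estimation error for a fixed sample size\<close>

lemma precision_column:
  assumes Sig: "pos_def_mat p \<Sigma>" and i: "i < p"
  shows "mat_inv \<Sigma> \<in> carrier_mat p p" "\<Sigma> *\<^sub>v col (mat_inv \<Sigma>) i = unit_vec p i"
proof -
  have S: "\<Sigma> \<in> carrier_mat p p" using Sig by (simp add: pos_def_mat_def)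
  have pos: "v \<bullet> (\<Sigma> *\<^sub>v v) > 0" if "v \<in> carrier_vec p" "v \<noteq> 0\<^sub>v p" for v
    using Sig that by (simp add: pos_def_mat_def)
  note inv = positive_form_mat_inv[OF S pos]
  show "mat_inv \<Sigma> \<in> carrier_mat p p" by (rule inv)
  have "\<Sigma> *\<^sub>v col (mat_inv \<Sigma>) i = col (\<Sigma> * mat_inv \<Sigma>) i"
    using i by (intro col_mult2[OF S inv(1), symmetric]) auto
  also have "\<dots> = unit_vec p i" using i by (simp add: inv(2))
  finally show "\<Sigma> *\<^sub>v col (mat_inv \<Sigma>) i = unit_vec p i" .
qed

text \<open>Here \<open>w\<close> is a column of the precision matrix, and \<open>w \<bullet> \<Sigma> w\<close> is its entry \<open>w $ i\<close>. The
  eigenvalue bound gives \<open>C0 (w $ i)\<^sup>2 \<le> C0 (w \<bullet> w) \<le> w $ i\<close>.\<close>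

lemma precision_column_variance_le:
  fixes \<Sigma> :: "real mat"
  assumes w: "w \<in> carrier_vec p" and i: "i < p" and Sw: "\<Sigma> *\<^sub>v w = unit_vec p i" and C0: "C0 > 0"
    and low: "C0 * (w \<bullet> w) \<le> w \<bullet> (\<Sigma> *\<^sub>v w)"
  shows "w \<bullet> (\<Sigma> *\<^sub>v w) \<le> 1 / C0"
proof -
  have wi: "w \<bullet> (\<Sigma> *\<^sub>v w) = w $ i" using i by (simp add: Sw)
  have "w $ i * w $ i \<le> (\<Sum>j<p. w $ j * w $ j)"
    using i by (intro member_le_sum[of i "{..<p}" "\<lambda>j. w $ j * w $ j"]) auto
  also have "\<dots> = w \<bullet> w" using w by (simp add: scalar_prod_def atLeast0LessThan)
  finally have "C0 * (w $ i * w $ i) \<le> w $ i"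
    using low wi C0 by (smt (verit) mult_left_mono)
  then have "w $ i * (C0 * w $ i) \<le> w $ i * 1" by (simp add: mult_ac)
  moreover have "0 \<le> w $ i"
    using low wi C0 scalar_prod_self_nonneg[of w] by (smt (verit) mult_nonneg_nonneg)
  ultimately have "C0 * w $ i \<le> 1"
    by (cases "w $ i = 0") (auto simp: mult_le_cancel_left)
  then show ?thesis using wi C0 by (simp add: field_simps)
qed

lemma symmetric_form_add_diff:
  fixes B :: "real mat"
  assumes B: "B \<in> carrier_mat p p" "transpose_mat B = B"
    and u: "u \<in> carrier_vec p" and w: "w \<in> carrier_vec p"
  shows "(u + w) \<bullet> (B *\<^sub>v (u + w)) = u \<bullet> (B *\<^sub>v u) + 2 * (u \<bullet> (B *\<^sub>v w)) + w \<bullet> (B *\<^sub>v w)"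
    and "(u - w) \<bullet> (B *\<^sub>v (u - w)) = u \<bullet> (B *\<^sub>v u) - 2 * (u \<bullet> (B *\<^sub>v w)) + w \<bullet> (B *\<^sub>v w)"
proof -
  have c: "B *\<^sub>v u \<in> carrier_vec p" "B *\<^sub>v w \<in> carrier_vec p" using B u w by auto
  note comm = symmetric_form_comm[OF B w u]
  show "(u + w) \<bullet> (B *\<^sub>v (u + w)) = u \<bullet> (B *\<^sub>v u) + 2 * (u \<bullet> (B *\<^sub>v w)) + w \<bullet> (B *\<^sub>v w)"
    using u w c comm mult_add_distrib_mat_vec[OF B(1) u w]
    by (simp add: scalar_prod_add_distrib[of _ p] add_scalar_prod_distrib[of _ p])
  show "(u - w) \<bullet> (B *\<^sub>v (u - w)) = u \<bullet> (B *\<^sub>v u) - 2 * (u \<bullet> (B *\<^sub>v w)) + w \<bullet> (B *\<^sub>v w)"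
    using u w c comm mult_minus_distrib_mat_vec[OF B(1) u w]
    by (simp add: scalar_prod_minus_distrib[of _ p] minus_scalar_prod_distrib[of _ p])
qed

text \<open>The bilinear form at \<open>(u, w)\<close> is a quarter of the difference of the quadratic forms at \<open>u + w\<close>
  and \<open>u - w\<close>; in the sum of the two error bounds the mixed terms cancel.\<close>

lemma bilinear_deviation_by_polarization:
  fixes S \<Sigma> :: "real mat"
  assumes S: "S \<in> carrier_mat p p" "transpose_mat S = S"
    and Sig: "\<Sigma> \<in> carrier_mat p p" "transpose_mat \<Sigma> = \<Sigma>"
    and u: "u \<in> carrier_vec p" and w: "w \<in> carrier_vec p"
    and add: "\<bar>(u + w) \<bullet> (S *\<^sub>v (u + w)) - (u + w) \<bullet> (\<Sigma> *\<^sub>v (u + w))\<bar> \<le> \<kappa> * ((u + w) \<bullet> (\<Sigma> *\<^sub>v (u + w)))"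
    and diff: "\<bar>(u - w) \<bullet> (S *\<^sub>v (u - w)) - (u - w) \<bullet> (\<Sigma> *\<^sub>v (u - w))\<bar> \<le> \<kappa> * ((u - w) \<bullet> (\<Sigma> *\<^sub>v (u - w)))"
  shows "\<bar>u \<bullet> (S *\<^sub>v w) - u \<bullet> (\<Sigma> *\<^sub>v w)\<bar> \<le> \<kappa> * (u \<bullet> (\<Sigma> *\<^sub>v u) + w \<bullet> (\<Sigma> *\<^sub>v w)) / 2"
proof -
  have "\<bar>x - y\<bar> \<le> \<kappa> * (tu + tw) / 2"
    if "\<bar>su + 2 * x + sw - (tu + 2 * y + tw)\<bar> \<le> \<kappa> * (tu + 2 * y + tw)"
      "\<bar>su - 2 * x + sw - (tu - 2 * y + tw)\<bar> \<le> \<kappa> * (tu - 2 * y + tw)" for su sw tu tw x y :: real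
  proof -
    have "\<kappa> * (tu + 2 * y + tw) + \<kappa> * (tu - 2 * y + tw) = 2 * (\<kappa> * (tu + tw))"
      by (simp add: algebra_simps)
    then show ?thesis using that by linarith
  qed
  then show ?thesis
    using add diff
    unfolding symmetric_form_add_diff[OF S u w] symmetric_form_add_diff[OF Sig u w] .
qed

text \<open>The unit vectors bound the diagonal of the sample covariance matrix; sums and differences with
  the columns of \<open>\<Omega>\<close> give the residuals by polarization.\<close>

definition test_vecs :: "nat \<Rightarrow> real mat \<Rightarrow> real vec set" where
  "test_vecs p \<Omega> = unit_vec p ` {..<p} \<union>
     (\<lambda>(i, j). unit_vec p j + col \<Omega> i) ` ({..<p} \<times> {..<p}) \<union>
     (\<lambda>(i, j). unit_vec p j - col \<Omega> i) ` ({..<p} \<times> {..<p})"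

text \<open>The integer grids on the supports of the columns, as vectors of full length.\<close>

definition grid_vecs :: "nat \<Rightarrow> real mat \<Rightarrow> nat \<Rightarrow> real vec set" where
  "grid_vecs p \<Omega> N = (\<Union>i<p. grid_vec p (set (col_support \<Omega> i)) `
     (set (col_support \<Omega> i) \<rightarrow>\<^sub>E {- int N..int N}))"

lemma test_vecs_props:
  assumes "\<Omega> \<in> carrier_mat p p"
  shows "finite (test_vecs p \<Omega>)" "test_vecs p \<Omega> \<subseteq> carrier_vec p" "card (test_vecs p \<Omega>) \<le> 3 * p\<^sup>2"
proof -
  show "finite (test_vecs p \<Omega>)" by (auto simp: test_vecs_def)
  show "test_vecs p \<Omega> \<subseteq> carrier_vec p" using assms by (auto simp: test_vecs_def)
  have "card (test_vecs p \<Omega>) \<le> card {..<p} + card ({..<p} \<times> {..<p}) + card ({..<p} \<times> {..<p})"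
    unfolding test_vecs_def
    by (intro order_trans[OF card_Un_le] add_mono card_image_le) auto
  also have "\<dots> \<le> 3 * p\<^sup>2" by (simp add: power2_eq_square)
  finally show "card (test_vecs p \<Omega>) \<le> 3 * p\<^sup>2" .
qed

lemma grid_vecs_props:
  assumes "\<And>i. i < p \<Longrightarrow> length (col_support \<Omega> i) = s"
  shows "finite (grid_vecs p \<Omega> N)" "grid_vecs p \<Omega> N \<subseteq> carrier_vec p"
    "card (grid_vecs p \<Omega> N) \<le> p * (2 * N + 1) ^ s"
proof -
  let ?F = "\<lambda>i. set (col_support \<Omega> i) \<rightarrow>\<^sub>E {- int N..int N}"
  have fin: "finite (?F i)" for i by (intro finite_PiE) auto
  then show "finite (grid_vecs p \<Omega> N)" by (auto simp: grid_vecs_def)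
  show "grid_vecs p \<Omega> N \<subseteq> carrier_vec p" by (auto simp: grid_vecs_def grid_vec_def)
  have "card (grid_vecs p \<Omega> N) \<le> (\<Sum>i<p. card (grid_vec p (set (col_support \<Omega> i)) ` ?F i))"
    unfolding grid_vecs_def by (rule card_UN_le) simp
  also have "\<dots> \<le> (\<Sum>i<p. card (?F i))"
    by (intro sum_mono card_image_le fin)
  also have "\<dots> = (\<Sum>i<p. (2 * N + 1) ^ s)"
  proof (intro sum.cong refl)
    fix i assume "i \<in> {..<p}"
    then have "card (set (col_support \<Omega> i)) = s"
      using assms distinct_card[OF col_support_props(1)] by simp
    moreover have "nat (1 + int N * 2) = 2 * N + 1" by simp
    ultimately show "card (?F i) = (2 * N + 1) ^ s"
      by (simp add: card_PiE algebra_simps)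
  qed
  finally show "card (grid_vecs p \<Omega> N) \<le> p * (2 * N + 1) ^ s" by simp
qed

lemma sample_cov_symmetric: "transpose_mat (sample_cov p n x) = sample_cov p n x"
  by (intro eq_matI) (auto simp: sample_cov_def mult.commute)

text \<open>The deterministic part: on every outcome where the test vectors deviate little and no grid vector
  has an exceptionally small form, both errors are at most a constant times \<open>\<kappa> s\<close>. The upper bound
  \<open>\<kappa>0\<close> on \<open>\<kappa>\<close> appears in the conditions on \<open>N\<close> so that the mesh of the grid can be fixed beforehand.
  The lower bound obtained for a block is \<open>c = C0 \<tau> / 32\<close>.\<close>

lemma estimation_error_bound:
  fixes \<Sigma> :: "real mat" and C0 \<kappa> \<kappa>0 \<tau> :: real and n p s N :: nat
  assumes Sig: "pos_def_mat p \<Sigma>" and Om: "\<Omega> = mat_inv \<Sigma>" and C0: "C0 > 0"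
    and low: "\<And>v. v \<in> carrier_vec p \<Longrightarrow> C0 * (v \<bullet> v) \<le> v \<bullet> (\<Sigma> *\<^sub>v v)"
    and upp: "\<And>v. v \<in> carrier_vec p \<Longrightarrow> v \<bullet> (\<Sigma> *\<^sub>v v) \<le> 1 / C0 * (v \<bullet> v)"
    and x: "\<And>k. k < n \<Longrightarrow> x k \<in> carrier_vec p" and n: "n \<ge> 2" and p: "p > 0"
    and s: "\<And>i. i < p \<Longrightarrow> length (col_support \<Omega> i) = s" and s1: "s \<ge> 1"
    and \<kappa>: "0 \<le> \<kappa>" "\<kappa> \<le> \<kappa>0" and \<tau>: "\<tau> > 0"
    and N: "2 * s \<le> N" "4 * sqrt ((1 + \<kappa>0) / C0) * s \<le> sqrt (C0 * \<tau> / 2) * N"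
    and dev: "\<And>a. a \<in> test_vecs p \<Omega> \<Longrightarrow>
      \<bar>a \<bullet> (sample_cov p n x *\<^sub>v a) - a \<bullet> (\<Sigma> *\<^sub>v a)\<bar> \<le> \<kappa> * (a \<bullet> (\<Sigma> *\<^sub>v a))"
    and ball: "\<And>a. a \<in> grid_vecs p \<Omega> N \<Longrightarrow>
      \<tau> / 2 * (a \<bullet> (\<Sigma> *\<^sub>v a)) \<le> a \<bullet> (sample_cov p n x *\<^sub>v a)"
  shows "\<bar>max_col_error \<Omega> (sample_cov p n x)\<bar> \<le> 32 / (C0\<^sup>2 * \<tau>) * \<kappa> * s"
    and "\<bar>mat_norm1 (prec_est \<Omega> (sample_cov p n x) - \<Omega>)\<bar> \<le> 32 / (C0\<^sup>2 * \<tau>) * \<kappa> * s"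
proof -
  let ?S = "sample_cov p n x"
  note S = sample_cov_carrier[of p n x] sample_cov_symmetric[of p n x]
  have SS: "\<Sigma> \<in> carrier_mat p p" "transpose_mat \<Sigma> = \<Sigma>"
    using Sig by (auto simp: pos_def_mat_def)
  have Omc: "\<Omega> \<in> carrier_mat p p" using precision_column(1)[OF Sig p] by (simp add: Om)
  define a where "a = sqrt (C0 * \<tau> / 2)"
  define b where "b = sqrt ((1 + \<kappa>0) / C0)"
  have a: "a > 0" "a\<^sup>2 = C0 * \<tau> / 2" using C0 \<tau> by (auto simp: a_def)
  have b: "b \<ge> 0" "b\<^sup>2 = (1 + \<kappa>0) / C0" using C0 \<kappa> by (auto simp: b_def)
  have var_e: "unit_vec p j \<bullet> (\<Sigma> *\<^sub>v unit_vec p j) \<le> 1 / C0" if "j < p" for j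
    using upp[of "unit_vec p j"] that by simp
  define c where "c = (a / 4)\<^sup>2"
  have c: "c > 0" "c = C0 * \<tau> / 32" using a by (auto simp: c_def power_divide)
  have lower: "c * (v \<bullet> v) \<le> v \<bullet> (?S *\<^sub>v v)"
    if i: "i < p" and v: "v \<in> carrier_vec p" "\<forall>j<p. \<Omega> $$ (j, i) = 0 \<longrightarrow> v $ j = 0" for i v
  proof -
    let ?J = "set (col_support \<Omega> i)"
    have J: "?J = {j. j < p \<and> \<Omega> $$ (j, i) \<noteq> 0}" using Omc by (simp add: col_support_props(2))
    have card: "card ?J = s" using s[OF i] distinct_card[OF col_support_props(1)] by metis
    show ?thesis
      unfolding c_def
    proof (rule sample_cov_lower_bound[OF x n, where J = ?J and N = N and b = b])
      show "?J \<subseteq> {..<p}" "0 < N" "0 \<le> a" "0 \<le> b" using J N s1 a b by auto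
      show "2 * card ?J \<le> N" "4 * b * card ?J \<le> a * N" using N card by (auto simp: a_def b_def)
      show "v \<in> carrier_vec p" by (rule v)
      show "v $ j = 0" if "j < p" "j \<notin> ?J" for j using that v(2) J by auto
    next
      fix j assume "j \<in> ?J"
      then have j: "j < p" using J by auto
      define q where "q = unit_vec p j \<bullet> (\<Sigma> *\<^sub>v unit_vec p j)"
      have q: "0 \<le> q" "q \<le> 1 / C0"
        using var_e[OF j] low[of "unit_vec p j"] j C0 by (auto simp: q_def)
      have "unit_vec p j \<in> test_vecs p \<Omega>" using j by (auto simp: test_vecs_def)
      from dev[OF this] have "unit_vec p j \<bullet> (?S *\<^sub>v unit_vec p j) \<le> (1 + \<kappa>) * q"
        by (simp add: q_def abs_le_iff algebra_simps)
      also have "\<dots> \<le> (1 + \<kappa>0) * (1 / C0)" using \<kappa> q by (intro mult_mono) auto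
      finally show "unit_vec p j \<bullet> (?S *\<^sub>v unit_vec p j) \<le> b\<^sup>2" by (simp add: b)
    next
      fix g assume g: "g \<in> ?J \<rightarrow>\<^sub>E {- int N..int N}"
      let ?u = "grid_vec p ?J g"
      have u: "?u \<in> carrier_vec p" by (simp add: grid_vec_def)
      have "?u \<in> grid_vecs p \<Omega> N" using g i by (auto simp: grid_vecs_def)
      from ball[OF this] have "\<tau> / 2 * (?u \<bullet> (\<Sigma> *\<^sub>v ?u)) \<le> ?u \<bullet> (?S *\<^sub>v ?u)" .
      moreover have "\<tau> / 2 * (C0 * (?u \<bullet> ?u)) \<le> \<tau> / 2 * (?u \<bullet> (\<Sigma> *\<^sub>v ?u))"
        using low[OF u] \<tau> by (intro mult_left_mono) auto
      ultimately show "a\<^sup>2 * (?u \<bullet> ?u) \<le> ?u \<bullet> (?S *\<^sub>v ?u)" by (simp add: a(2) mult_ac)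
    qed
  qed
  have residual: "\<bar>(?S *\<^sub>v col \<Omega> i) $ j - unit_vec p i $ j\<bar> \<le> \<kappa> / C0" if i: "i < p" and j: "j < p" for i j
  proof -
    let ?e = "unit_vec p j :: real vec" and ?w = "col \<Omega> i"
    have w: "?w \<in> carrier_vec p" using Omc i by auto
    have e: "?e \<in> carrier_vec p" by simp
    have Sw: "\<Sigma> *\<^sub>v ?w = unit_vec p i" using precision_column(2)[OF Sig i] by (simp add: Om)
    have T: "?e + ?w \<in> test_vecs p \<Omega>" "?e - ?w \<in> test_vecs p \<Omega>"
      using i j by (auto simp: test_vecs_def)
    have "\<bar>?e \<bullet> (?S *\<^sub>v ?w) - ?e \<bullet> (\<Sigma> *\<^sub>v ?w)\<bar> \<le> \<kappa> * (?e \<bullet> (\<Sigma> *\<^sub>v ?e) + ?w \<bullet> (\<Sigma> *\<^sub>v ?w)) / 2"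
      by (rule bilinear_deviation_by_polarization[OF S SS e w dev[OF T(1)] dev[OF T(2)]])
    also have "\<dots> \<le> \<kappa> * (1 / C0 + 1 / C0) / 2"
      using var_e[OF j] precision_column_variance_le[OF w i Sw C0 low[OF w]] \<kappa>
      by (intro divide_right_mono mult_left_mono add_mono) auto
    finally have "\<bar>?e \<bullet> (?S *\<^sub>v ?w) - ?e \<bullet> unit_vec p i\<bar> \<le> \<kappa> / C0" by (simp add: Sw)
    moreover have "?e \<bullet> (?S *\<^sub>v ?w) = (?S *\<^sub>v ?w) $ j"
      using S(1) w j by (intro scalar_prod_left_unit) auto
    moreover have "?e \<bullet> unit_vec p i = (unit_vec p i $ j :: real)"
      using j by (intro scalar_prod_left_unit) auto
    ultimately show ?thesis by simp
  qed
  have \<rho>: "\<kappa> / C0 \<ge> 0" using \<kappa> C0 by simp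
  have est: "nz_col_est \<Omega> ?S i \<in> carrier_vec (length (col_support \<Omega> i))"
    "l2_norm (nz_col_est \<Omega> ?S i - nz_col \<Omega> i) \<le> sqrt (length (col_support \<Omega> i)) * (\<kappa> / C0) / c"
    if i: "i < p" for i
    by (rule nz_col_est_error[OF Omc S(1) i c(1) \<rho> residual[OF i] lower[OF i]]; assumption)+
  define r where "r = sqrt s * (\<kappa> / C0) / c"
  have err: "l2_norm (nz_col_est \<Omega> ?S i - nz_col \<Omega> i) \<le> r" if "i < p" for i
    unfolding r_def s[OF that, symmetric] by (rule est(2)[OF that])
  \<comment> \<open>The Euclidean error is of order sqrt s; the common bound allows another factor sqrt s, which the 1-norm uses up.\<close>
  have eq: "sqrt s * r = 32 / (C0\<^sup>2 * \<tau>) * \<kappa> * s"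
  proof -
    have "sqrt s * r = (sqrt s * sqrt s) * (\<kappa> / C0) / c"
      unfolding r_def by (simp only: times_divide_eq_right mult.assoc)
    also have "sqrt s * sqrt s = s" by simp
    finally show ?thesis using C0 \<tau> by (simp add: c(2) power2_eq_square field_simps)
  qed
  have r: "r \<ge> 0"
    unfolding r_def using \<kappa>(1) C0 c(1) by (intro divide_nonneg_pos mult_nonneg_nonneg) auto
  have "r \<le> sqrt s * r" using s1 r by (simp add: mult_le_cancel_right1)
  then show "\<bar>max_col_error \<Omega> ?S\<bar> \<le> 32 / (C0\<^sup>2 * \<tau>) * \<kappa> * s"
    unfolding eq[symmetric]
  proof (intro max_col_error_le)
    show "0 < dim_col \<Omega>" using Omc p by simp
    fix i assume "i < dim_col \<Omega>"
    then have "l2_norm (nz_col_est \<Omega> ?S i - nz_col \<Omega> i) \<le> r" using Omc by (intro err) simp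
    then show "l2_norm (nz_col_est \<Omega> ?S i - nz_col \<Omega> i) \<le> sqrt s * r"
      using \<open>r \<le> sqrt s * r\<close> by linarith
  qed
  show "\<bar>mat_norm1 (prec_est \<Omega> ?S - \<Omega>)\<bar> \<le> 32 / (C0\<^sup>2 * \<tau>) * \<kappa> * s"
    unfolding eq[symmetric]
  proof (rule prec_est_error_le[OF Omc p])
    fix i assume i: "i < p"
    show "nz_col_est \<Omega> ?S i \<in> carrier_vec (length (col_support \<Omega> i))" by (rule est(1)[OF i])
    show "sqrt (length (col_support \<Omega> i)) * l2_norm (nz_col_est \<Omega> ?S i - nz_col \<Omega> i) \<le> sqrt s * r"
      unfolding s[OF i] using err[OF i] by (intro mult_left_mono) auto
  qed
qed

text \<open>The first summand of the probability comes from at most \<open>3 p\<^sup>2\<close> test vectors, each failing with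
  probability at most \<open>4 / p ^ 4\<close>, and the second from the grid vectors.\<close>

lemma (in prob_space) finite_sample_error_bound:
  fixes \<Sigma> :: "real mat" and C0 A B :: real and n p s N :: nat
  assumes iid: "iid_multivariate_normal M n p X \<mu> \<Sigma>"
    and Sig: "pos_def_mat p \<Sigma>" and Om: "\<Omega> = mat_inv \<Sigma>" and C0: "C0 > 0"
    and ev: "\<And>l. eigenvalue \<Sigma> l \<Longrightarrow> C0 \<le> l \<and> l \<le> inverse C0"
    and n: "n \<ge> 2" and L: "1 \<le> ln p" "ln p \<le> A * n"
    and s: "\<And>i. i < p \<Longrightarrow> card {j. j < p \<and> \<Omega> $$ (j, i) \<noteq> 0} = s" and s1: "s \<ge> 1"
    and N: "2 * s \<le> N"
      "4 * sqrt ((1 + dev_const A * sqrt A) / C0) * s \<le> sqrt (C0 * small_ball_const B / 2) * N"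
  shows "\<exists>E \<in> events. prob E \<le> 12 / p + p * (2 * N + 1) ^ s * exp (- B * (n div 2)) \<and>
    (\<forall>\<omega> \<in> space M - E. let S = sample_cov p n (\<lambda>k. X k \<omega>);
        e = 32 * dev_const A / (C0\<^sup>2 * small_ball_const B) * (s * sqrt (ln p / n)) in
      \<bar>max_col_error \<Omega> S\<bar> \<le> e \<and> \<bar>mat_norm1 (prec_est \<Omega> S - \<Omega>)\<bar> \<le> e)"
proof -
  have p: "p > 0" using L by (cases p) auto
  have A: "A > 0" using L n by (smt (verit) mult_nonpos_nonneg of_nat_0_le_iff)
  have SS: "\<Sigma> \<in> carrier_mat p p" "transpose_mat \<Sigma> = \<Sigma>"
    using Sig by (auto simp: pos_def_mat_def)
  have Omc: "\<Omega> \<in> carrier_mat p p" using precision_column(1)[OF Sig p] by (simp add: Om)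
  have len: "length (col_support \<Omega> i) = s" if "i < p" for i
    using s[OF that] Omc by (simp add: length_col_support)
  note T = test_vecs_props[OF Omc] and G = grid_vecs_props[OF len, of p N]
  define \<kappa> where "\<kappa> = dev_const A * sqrt (ln p / n)"
  define \<tau> where "\<tau> = small_ball_const B"
  have \<tau>: "\<tau> > 0" by (simp add: \<tau>_def small_ball_const_def)
  have dc: "dev_const A \<ge> 0" using A by (simp add: dev_const_def)
  have "sqrt (ln p / n) \<le> sqrt A" using L n by (simp add: pos_divide_le_eq)
  then have \<kappa>: "0 \<le> \<kappa>" "\<kappa> \<le> dev_const A * sqrt A"
    using dc L by (auto simp: \<kappa>_def intro!: mult_left_mono)
  have "\<exists>E \<in> events. prob E \<le> card (test_vecs p \<Omega>) * (4 * exp (- 4 * ln p)) \<and>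
    (\<forall>\<omega> \<in> space M - E. \<forall>a \<in> test_vecs p \<Omega>.
      \<bar>a \<bullet> (sample_cov p n (\<lambda>k. X k \<omega>) *\<^sub>v a) - a \<bullet> (\<Sigma> *\<^sub>v a)\<bar> \<le> \<kappa> * (a \<bullet> (\<Sigma> *\<^sub>v a)))"
    unfolding \<kappa>_def using T(2)
    by (intro finite_union_of_exceptional_events[OF T(1)] sample_cov_deviation[OF iid Sig _ n L]) auto
  then obtain E1 where E1: "E1 \<in> events" "prob E1 \<le> card (test_vecs p \<Omega>) * (4 * exp (- 4 * ln p))"
    and dev: "\<And>\<omega> a. \<omega> \<in> space M - E1 \<Longrightarrow> a \<in> test_vecs p \<Omega> \<Longrightarrow>
      \<bar>a \<bullet> (sample_cov p n (\<lambda>k. X k \<omega>) *\<^sub>v a) - a \<bullet> (\<Sigma> *\<^sub>v a)\<bar> \<le> \<kappa> * (a \<bullet> (\<Sigma> *\<^sub>v a))"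
    by blast
  have "\<exists>E \<in> events. prob E \<le> card (grid_vecs p \<Omega> N) * exp (- B * (n div 2)) \<and>
    (\<forall>\<omega> \<in> space M - E. \<forall>a \<in> grid_vecs p \<Omega> N.
      \<tau> / 2 * (a \<bullet> (\<Sigma> *\<^sub>v a)) \<le> a \<bullet> (sample_cov p n (\<lambda>k. X k \<omega>) *\<^sub>v a))"
    unfolding \<tau>_def using G(2)
    by (intro finite_union_of_exceptional_events[OF G(1)] sample_cov_small_ball[OF iid Sig _ n]) auto
  then obtain E2 where E2: "E2 \<in> events" "prob E2 \<le> card (grid_vecs p \<Omega> N) * exp (- B * (n div 2))"
    and ball: "\<And>\<omega> a. \<omega> \<in> space M - E2 \<Longrightarrow> a \<in> grid_vecs p \<Omega> N \<Longrightarrow>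
      \<tau> / 2 * (a \<bullet> (\<Sigma> *\<^sub>v a)) \<le> a \<bullet> (sample_cov p n (\<lambda>k. X k \<omega>) *\<^sub>v a)"
    by blast
  have "prob E1 \<le> 12 / p"
  proof -
    have "exp (4 * ln (real p)) = real p ^ 4"
      using exp_of_nat_mult[of 4 "ln (real p)"] p by simp
    then have e: "exp (- 4 * ln (real p)) = 1 / real p ^ 4"
      by (simp add: exp_minus inverse_eq_divide)
    have "prob E1 \<le> real (3 * p\<^sup>2) * (4 * (1 / real p ^ 4))"
      using E1(2) mult_right_mono[OF of_nat_mono[OF T(3)], of "4 * (1 / real p ^ 4)"] unfolding e
      by (smt (verit) divide_nonneg_nonneg of_nat_0_le_iff zero_le_power)
    also have "\<dots> = 12 / (real p)\<^sup>2"
      using p by (simp add: power2_eq_square power4_eq_xxxx)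
    also have "\<dots> \<le> 12 / p"
      using p by (intro divide_left_mono) (auto simp: power2_eq_square)
    finally show ?thesis .
  qed
  moreover have "prob E2 \<le> real (p * (2 * N + 1) ^ s) * exp (- B * (n div 2))"
    by (rule order_trans[OF E2(2) mult_right_mono[OF of_nat_mono[OF G(3)]]]) simp_all
  ultimately have "prob (E1 \<union> E2) \<le> 12 / p + p * (2 * N + 1) ^ s * exp (- B * (n div 2))"
    using measure_Un_le[OF E1(1) E2(1)] by simp
  moreover have "let S = sample_cov p n (\<lambda>k. X k \<omega>);
        e = 32 * dev_const A / (C0\<^sup>2 * small_ball_const B) * (s * sqrt (ln p / n)) in
      \<bar>max_col_error \<Omega> S\<bar> \<le> e \<and> \<bar>mat_norm1 (prec_est \<Omega> S - \<Omega>)\<bar> \<le> e"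
    if w: "\<omega> \<in> space M - (E1 \<union> E2)" for \<omega>
  proof -
    have x: "X k \<omega> \<in> carrier_vec p" if "k < n" for k
      using iid that w by (auto simp: iid_multivariate_normal_def multivariate_normal_def)
    have low: "C0 * (v \<bullet> v) \<le> v \<bullet> (\<Sigma> *\<^sub>v v)" and upp: "v \<bullet> (\<Sigma> *\<^sub>v v) \<le> 1 / C0 * (v \<bullet> v)"
      if "v \<in> carrier_vec p" for v
      using symmetric_form_eigenvalue_bounds[OF SS p ev that] by (auto simp: inverse_eq_divide)
    have w1: "\<omega> \<in> space M - E1" "\<omega> \<in> space M - E2" using w by auto
    have e: "32 / (C0\<^sup>2 * \<tau>) * \<kappa> * s
        = 32 * dev_const A / (C0\<^sup>2 * small_ball_const B) * (s * sqrt (ln p / n))"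
      by (simp add: \<kappa>_def \<tau>_def)
    show ?thesis
      unfolding Let_def e[symmetric]
      using estimation_error_bound[OF Sig Om C0 low upp x n p len s1 \<kappa> \<tau> N[folded \<tau>_def]
          dev[OF w1(1)] ball[OF w1(2)]] by blast
  qed
  ultimately show ?thesis using E1(1) E2(1) by (intro bexI[of _ "E1 \<union> E2"]) auto
qed

section \<open>Rates of convergence\<close>

theorem theorem2:
  fixes M :: "nat \<Rightarrow> 'a measure"
    and p s0 :: "nat \<Rightarrow> nat"
    and \<mu> :: "nat \<Rightarrow> real vec"
    and \<Sigma> \<Omega> :: "nat \<Rightarrow> real mat"
    and X :: "nat \<Rightarrow> nat \<Rightarrow> 'a \<Rightarrow> real vec"
    and C0 :: real
  assumes prob: "\<And>n. prob_space (M n)"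
    and p_grows: "filterlim p at_top sequentially"
    and log_p: "(\<lambda>n. ln (real (p n))) \<in> O(\<lambda>n. real n)"
    and mu: "\<And>n. \<mu> n \<in> carrier_vec (p n)"
    and Sigma: "\<And>n. pos_def_mat (p n) (\<Sigma> n)"
    and Omega: "\<And>n. \<Omega> n = mat_inv (\<Sigma> n)"
    and sample: "\<And>n. iid_multivariate_normal (M n) n (p n) (X n) (\<mu> n) (\<Sigma> n)"
    and s0_pos: "\<And>n. s0 n \<ge> 1"
    and s0_nonzero: "\<And>n i. i < p n \<Longrightarrow> card {j. j < p n \<and> \<Omega> n $$ (j, i) \<noteq> 0} = s0 n"
    and s0_small: "(\<lambda>n. real (s0 n)) \<in> o(\<lambda>n. sqrt (real n))"
    and C0_pos: "C0 > 0"
    and eigenvalues: "\<And>n l. eigenvalue (\<Sigma> n) l \<Longrightarrow> C0 \<le> l \<and> l \<le> inverse C0"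
  shows
    "bigO_in_prob M
       (\<lambda>n \<omega>. max_col_error (\<Omega> n) (sample_cov (p n) n (\<lambda>k. X n k \<omega>)))
       (\<lambda>n. real (s0 n) * sqrt (ln (real (p n)) / real n)) \<and>
     ((\<exists>C. \<forall>n. mat_norm1 (\<Omega> n) \<le> C) \<longrightarrow>
      bigO_in_prob M
        (\<lambda>n \<omega>. mat_norm1 (prec_est (\<Omega> n) (sample_cov (p n) n (\<lambda>k. X n k \<omega>)) - \<Omega> n))
        (\<lambda>n. real (s0 n) * sqrt (ln (real (p n)) / real n)))"
proof -
  obtain A where A: "A > 0" and A_ev: "\<forall>\<^sub>F n in sequentially. ln (real (p n)) \<le> A * real n"
  proof -
    obtain c where "c > 0" "\<forall>\<^sub>F n in sequentially. norm (ln (real (p n))) \<le> c * norm (real n)"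
      using log_p by (auto elim: landau_o.bigE)
    moreover from this(2) have "\<forall>\<^sub>F n in sequentially. ln (real (p n)) \<le> c * real n"
      by (rule eventually_mono) auto
    ultimately show ?thesis using that by blast
  qed
  \<comment> \<open>One third of B, the share that n div 2 retains, beats the rate A of the columns and the rate 1 of the grid, and leaves exp (- n).\<close>
  define B where "B = 3 * (A + 2)"
  define \<tau> where "\<tau> = small_ball_const B"
  have \<tau>: "\<tau> > 0" by (simp add: \<tau>_def small_ball_const_def)
  define b where "b = sqrt ((1 + dev_const A * sqrt A) / C0)"
  define a where "a = sqrt (C0 * \<tau> / 2)"
  have a: "a > 0" using C0_pos \<tau> by (simp add: a_def)
  \<comment> \<open>The grid size N is m times s0; both conditions on N become conditions on m alone.\<close>
  define m :: nat where "m = nat \<lceil>4 * b / a\<rceil> + 2"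
  have m: "m \<ge> 2" "4 * b \<le> a * m"
  proof -
    have "4 * b / a \<le> m" unfolding m_def by linarith
    then show "4 * b \<le> a * m" using a by (simp add: field_simps)
  qed (simp add: m_def)
  define D where "D = 32 * dev_const A / (C0\<^sup>2 * \<tau>)"
  \<comment> \<open>The left-hand side bounds the logarithm of the number of grid points on one support.\<close>
  have s0_ev: "\<forall>\<^sub>F n in sequentially. 3 * m * (real (s0 n))\<^sup>2 \<le> n"
  proof -
    have "\<forall>\<^sub>F n in sequentially. norm (real (s0 n)) \<le> 1 / (3 * m) * norm (sqrt (real n))"
      by (rule landau_o.smallD[OF s0_small]) (use m in auto)
    then show ?thesis
    proof (rule eventually_mono)
      fix n assume "norm (real (s0 n)) \<le> 1 / (3 * m) * norm (sqrt (real n))"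
      then have "3 * m * real (s0 n) \<le> sqrt n" using m by (simp add: field_simps)
      then have "(3 * m * real (s0 n))\<^sup>2 \<le> (sqrt n)\<^sup>2" by (intro power_mono) auto
      then have le: "(3 * m)\<^sup>2 * (real (s0 n))\<^sup>2 \<le> n" by (simp add: power_mult_distrib)
      have "real (3 * m) \<le> (real (3 * m))\<^sup>2" using m by (intro self_le_power) auto
      then have "real (3 * m) * (real (s0 n))\<^sup>2 \<le> (real (3 * m))\<^sup>2 * (real (s0 n))\<^sup>2"
        by (intro mult_right_mono) auto
      then show "3 * m * (real (s0 n))\<^sup>2 \<le> n" using le by simp
    qed
  qed
  have main: "\<forall>\<^sub>F n in sequentially. \<exists>E \<in> sets (M n). measure (M n) E \<le> \<epsilon> \<and>
      (\<forall>\<omega> \<in> space (M n) - E. let S = sample_cov (p n) n (\<lambda>k. X n k \<omega>);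
        e = D * (s0 n * sqrt (ln (p n) / n)) in
        \<bar>max_col_error (\<Omega> n) S\<bar> \<le> e \<and> \<bar>mat_norm1 (prec_est (\<Omega> n) S - \<Omega> n)\<bar> \<le> e)"
    if \<epsilon>: "\<epsilon> > 0" for \<epsilon> :: real
  proof -
    have p3: "\<forall>\<^sub>F n in sequentially. p n \<ge> 3"
      using p_grows by (simp add: filterlim_at_top)
    have p_eps: "\<forall>\<^sub>F n in sequentially. 12 / real (p n) \<le> \<epsilon> / 2"
    proof -
      have "\<forall>\<^sub>F n in sequentially. p n \<ge> nat \<lceil>24 / \<epsilon>\<rceil>"
        using p_grows unfolding filterlim_at_top by blast
      with p3 show ?thesis
      proof eventually_elim
        case (elim n)
        then have "24 / \<epsilon> \<le> p n" by linarith
        then show ?case using \<epsilon> elim by (simp add: field_simps)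
      qed
    qed
    have exp_eps: "\<forall>\<^sub>F n in sequentially. exp (- real n) \<le> \<epsilon> / 2"
    proof -
      have "(\<lambda>n. exp (- real n)) \<longlonglongrightarrow> 0"
        by (intro filterlim_compose[OF exp_at_bot] filterlim_uminus_at_bot_at_top[THEN filterlim_compose]
            filterlim_real_sequentially)
      then have "\<forall>\<^sub>F n in sequentially. exp (- real n) < \<epsilon> / 2"
        using \<epsilon> by (intro order_tendstoD) auto
      then show ?thesis by (rule eventually_mono) simp
    qed
    show ?thesis
      using A_ev s0_ev p3 p_eps exp_eps eventually_ge_at_top[of 2]
    proof eventually_elim
      case (elim n)
      define s where "s = s0 n"
      define N where "N = m * s"
      have s: "s \<ge> 1" using s0_pos by (simp add: s_def)
      have L: "1 \<le> ln (real (p n))"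
      proof -
        have "exp 1 \<le> real (p n)" using exp_le elim(3) by linarith
        then show ?thesis using elim(3) by (simp add: ln_ge_iff)
      qed
      have N: "2 * s \<le> N" "4 * sqrt ((1 + dev_const A * sqrt A) / C0) * s
          \<le> sqrt (C0 * small_ball_const B / 2) * N"
        using m mult_right_mono[OF m(2), of "real s"]
        by (auto simp: N_def a_def b_def \<tau>_def mult_ac)
      have card: "card {j. j < p n \<and> \<Omega> n $$ (j, i) \<noteq> 0} = s" if "i < p n" for i
        using s0_nonzero[OF that] by (simp add: s_def)
      interpret prob_space "M n" by (rule prob)
      have "\<exists>E \<in> events. prob E \<le> 12 / p n + p n * (2 * N + 1) ^ s * exp (- B * (n div 2)) \<and>
        (\<forall>\<omega> \<in> space (M n) - E. let S = sample_cov (p n) n (\<lambda>k. X n k \<omega>);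
          e = 32 * dev_const A / (C0\<^sup>2 * small_ball_const B) * (s * sqrt (ln (p n) / n)) in
          \<bar>max_col_error (\<Omega> n) S\<bar> \<le> e \<and> \<bar>mat_norm1 (prec_est (\<Omega> n) S - \<Omega> n)\<bar> \<le> e)"
        by (rule finite_sample_error_bound[OF sample Sigma Omega C0_pos eigenvalues elim(6) L elim(1)
            card s N])
      then obtain E where E: "E \<in> events"
        "prob E \<le> 12 / p n + p n * (2 * N + 1) ^ s * exp (- B * (n div 2))"
        "\<forall>\<omega> \<in> space (M n) - E. let S = sample_cov (p n) n (\<lambda>k. X n k \<omega>);
          e = 32 * dev_const A / (C0\<^sup>2 * small_ball_const B) * (s * sqrt (ln (p n) / n)) in
          \<bar>max_col_error (\<Omega> n) S\<bar> \<le> e \<and> \<bar>mat_norm1 (prec_est (\<Omega> n) S - \<Omega> n)\<bar> \<le> e"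
        by (elim bexE conjE)
      have "real (p n) * (2 * N + 1) ^ s * exp (- B * (n div 2)) \<le> exp (- real n)"
      proof -
        have "real (p n) = exp (ln (real (p n)))" using elim(3) by simp
        also have "\<dots> \<le> exp (A * n)" using elim(1) by simp
        finally have e1: "real (p n) \<le> exp (A * n)" .
        have "real (2 * N + 1) \<le> exp (3 * m * s)"
        proof -
          have "1 \<le> N" using N(1) s by linarith
          then have "real (2 * N + 1) \<le> 3 * real N" by simp
          also have "\<dots> = real (3 * m * s)" by (simp add: N_def)
          also have "\<dots> \<le> exp (real (3 * m * s))" by (rule order_trans[OF _ exp_ge_add_one_self]) simp
          finally show ?thesis by simp
        qed
        then have "real (2 * N + 1) ^ s \<le> exp (3 * m * s) ^ s" by (intro power_mono) auto
        also have "\<dots> = exp (3 * m * (real s)\<^sup>2)"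
          by (simp add: exp_of_nat_mult[symmetric] power2_eq_square mult_ac)
        also have "\<dots> \<le> exp (real n)" using elim(2) by (simp add: s_def)
        finally have e2: "real (2 * N + 1) ^ s \<le> exp (real n)" .
        have e3: "exp (- B * (n div 2)) \<le> exp (- (A + 2) * n)"
        proof -
          have "n \<le> 3 * (n div 2)" using elim(6) by presburger
          from of_nat_mono[OF this, where 'a = real] have "real n \<le> 3 * real (n div 2)" by simp
          then have "(A + 2) * real n \<le> (A + 2) * (3 * real (n div 2))"
            using A by (intro mult_left_mono) auto
          then show ?thesis by (simp add: B_def algebra_simps)
        qed
        have "real (p n) * real (2 * N + 1) ^ s * exp (- B * (n div 2))
            \<le> exp (A * n) * exp (real n) * exp (- (A + 2) * n)"
          using e1 e2 e3 by (intro mult_mono) auto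
        also have "\<dots> = exp (- real n)" by (simp add: exp_add[symmetric] algebra_simps)
        finally show ?thesis by simp
      qed
      then have "prob E \<le> \<epsilon>" using E(2) elim(4,5) by simp
      then show ?case
        using E(1,3) unfolding D_def \<tau>_def s_def[symmetric] by (intro bexI[of _ E] conjI)
    qed
  qed
  have bound: "bigO_in_prob M Z (\<lambda>n. real (s0 n) * sqrt (ln (real (p n)) / real n))"
    if Z: "\<And>n \<omega>. (let S = sample_cov (p n) n (\<lambda>k. X n k \<omega>);
        e = D * (s0 n * sqrt (ln (p n) / n)) in
        \<bar>max_col_error (\<Omega> n) S\<bar> \<le> e \<and> \<bar>mat_norm1 (prec_est (\<Omega> n) S - \<Omega> n)\<bar> \<le> e)
        \<Longrightarrow> \<bar>Z n \<omega>\<bar> \<le> D * (s0 n * sqrt (ln (p n) / n))" for Z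
    unfolding bigO_in_prob_def
  proof (intro allI impI exI[of _ D])
    fix \<epsilon> :: real assume "\<epsilon> > 0"
    from main[OF this] show "\<forall>\<^sub>F n in sequentially. \<exists>E \<in> sets (M n).
        {\<omega> \<in> space (M n). \<bar>Z n \<omega>\<bar> > D * \<bar>real (s0 n) * sqrt (ln (real (p n)) / real n)\<bar>} \<subseteq> E
        \<and> measure (M n) E \<le> \<epsilon>"
    proof (rule eventually_mono, elim bexE conjE, intro bexI conjI subsetI)
      fix n E \<omega>
      assume E: "\<forall>\<omega> \<in> space (M n) - E. let S = sample_cov (p n) n (\<lambda>k. X n k \<omega>);
          e = D * (s0 n * sqrt (ln (p n) / n)) in
          \<bar>max_col_error (\<Omega> n) S\<bar> \<le> e \<and> \<bar>mat_norm1 (prec_est (\<Omega> n) S - \<Omega> n)\<bar> \<le> e"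
        and w: "\<omega> \<in> {\<omega> \<in> space (M n). \<bar>Z n \<omega>\<bar> > D * \<bar>real (s0 n) * sqrt (ln (real (p n)) / real n)\<bar>}"
      have D: "D \<ge> 0" using A \<tau> by (simp add: D_def dev_const_def)
      show "\<omega> \<in> E"
      proof (rule ccontr)
        assume "\<omega> \<notin> E"
        then have "\<bar>Z n \<omega>\<bar> \<le> D * (s0 n * sqrt (ln (p n) / n))" using bspec[OF E, of \<omega>] w by (intro Z) simp
        also have "\<dots> \<le> D * \<bar>s0 n * sqrt (ln (p n) / n)\<bar>" using D by (intro mult_left_mono) auto
        finally show False using w by simp
      qed
    qed
  qed
  show ?thesis
  proof (intro conjI impI)
    show "bigO_in_prob M
       (\<lambda>n \<omega>. max_col_error (\<Omega> n) (sample_cov (p n) n (\<lambda>k. X n k \<omega>)))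
       (\<lambda>n. real (s0 n) * sqrt (ln (real (p n)) / real n))"
      by (rule bound) (simp only: Let_def)
    show "bigO_in_prob M
        (\<lambda>n \<omega>. mat_norm1 (prec_est (\<Omega> n) (sample_cov (p n) n (\<lambda>k. X n k \<omega>)) - \<Omega> n))
        (\<lambda>n. real (s0 n) * sqrt (ln (real (p n)) / real n))"
      by (rule bound) (simp only: Let_def)
  qed
qed
end
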